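(* Let $p\in[1,+\infty)$, $p\neq d_y/2$. Suppose: (i) there is a constant $a>p$ such that $\mathbb{E}[\exp(\|\varepsilon\|^a)]<+\infty$; (ii) for a.e. $x\in\mathcal{X}$, every $n$ and any $\alpha\in(0,1)$ there exists a constant $\kappa_{p,n}(\alpha,x)>0$ such that $$\mathbb{P}\{\|f^*(x)-\hat f_n(x)\|^p>\kappa_{p,n}^p(\alpha,x)\}\le\alpha,\qquad \mathbb{P}\Big\{\tfrac1n\sum_{i=1}^n\|f^*(x^i)-\hat f_n(x^i)\|^p>\kappa_{p,n}^p(\alpha,x)\Big\}\le\alpha;$$ (iii) $c(\cdot,y)$ is lower semicontinuous on $\mathcal Z$ for each $y\in\mathcal Y$, $c(z,\cdot)$ is continuous on $\mathcal Y$ for each $z\in\mathcal Z$, and there is a constant $B_{c,p}\ge0$ with $|c(z,y)|\le B_{c,p}(1+\|y\|^p)$ for all $z\in\mathcal Z$, $y\in\mathcal Y$; (iv) the sequence of risk levels $\{\alpha_n\}\subset(0,1)$ satisfies $\sum_n\alpha_n<\infty$ and $\lim_{n\to\infty}\zeta_n(\alpha_n,x)=0$ for a.e. $x\in\mathcal X$, with the radius $\zeta_n$ defined in the context; (v) the samples $\{\varepsilon^i\}_{i=1}^n$ are i.i.d.; (vi) at least one of the following holds: (A) for each $z\in\mathcal Z$, $c(z,\cdot)$ is Lipschitz continuous on $\mathcal Y$ with Lipschitz constant $L_1(z)$; or (B) $p\ge2$ and, for each $z\in\mathcal Z$, $c(z,\cdot)$ is differentiable on $\mathcal Y$ with $\mathbb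 E[\|\nabla c(z,f^*(x)+\varepsilon)\|^2]<+\infty$ for a.e. $x\in\mathcal X$ and $\|\nabla c(z,\bar y)-\nabla c(z,y)\|\le L_2(z)\|\bar y-y\|$ for all $y,\bar y\in\mathcal Y$ (gradients with respect to the second argument). Then, for a.e. $x\in\mathcal X$, the Wasserstein ER-DRO problem with ambiguity set $\hat{\mathcal P}_n(x;\zeta_n(\alpha_n,x))$ satisfies $$|\hat v^{DRO}_n(x)-v^*(x)|=O_p(\zeta_n(\alpha_n,x)),\qquad |g(\hat z^{DRO}_n(x);x)-v^*(x)|=O_p(\zeta_n(\alpha_n,x)).$$
   Context: Setup. $Y=f^*(X)+\varepsilon$, where $X$ is a random vector with support $\mathcal X\subseteq\mathbb R^{d_x}$ and distribution $P_X$, $Y$ has nonempty convex support $\mathcal Y\subseteq\mathbb R^{d_y}$, $f^*(x):=\mathbb E[Y\mid X=x]$, and the zero-mean error $\varepsilon$ (distribution $P_\varepsilon$) is independent of $X$. $P_{Y\mid X=x}$ is the conditional distribution of $Y$ given $X=x$, i.e. the law of $f^*(x)+\varepsilon$. "A.e. $x$" is with respect to $P_X$. $\|\cdot\|$ is the Euclidean norm. $\mathcal Z\subseteq\mathbb R^{d_z}$ is nonempty and compact, $c:\mathcal Z\times\mathcal Y\to\mathbb R$, $\mathbb E|c(z,f^*(x)+\varepsilon)|<\infty$ for each $z\in\mathcal Z$ and a.e. $x$, and $g(z;x):=\mathbb E[c(z,f^*(x)+\varepsilon)]$ is lower semicontinuous in $z$ on $\mathcal Z$ for a.e. $x$. The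 true problem is $v^*(x):=\min_{z\in\mathcal Z}g(z;x)$. All functions, sets and selections are assumed measurable. Data. $\mathcal D_n=\{(y^i,x^i)\}_{i=1}^n$ are joint observations of $(Y,X)$, $\varepsilon^i:=y^i-f^*(x^i)$; $\hat f_n$ is an estimate of $f^*$ built from $\mathcal D_n$ by a regression method, with residuals $\hat\varepsilon^i_n:=y^i-\hat f_n(x^i)$. Probabilities $\mathbb P$ refer to the data; $V_n=O_p(W_n)$ means $V_n=R_nW_n$ with $\{R_n\}$ bounded in probability. With $\mathrm{proj}_{\mathcal Y}$ the orthogonal projection onto $\mathcal Y$ and $\delta$ the Dirac measure, $$P^*_n(x):=\tfrac1n\sum_{i=1}^n\delta_{f^*(x)+\varepsilon^i},\qquad \hat P^{ER}_n(x):=\tfrac1n\sum_{i=1}^n\delta_{\mathrm{proj}_{\mathcal Y}(\hat f_n(x)+\hat\varepsilon^i_n)} .$$ Wasserstein ER-DRO. $\mathcal P(\mathcal Y)$ is the set of probability distributions supported in $\mathcal Y$; $d_{W,p}(Q_1,Q_2):=\big(\inf_\pi\int\|y_1-y_2\|^p\,d\pi\big)^{1/p}$, infimum over couplings $\pi$ of $Q_1,Q_2$. For $\zeta\ge0$, $\hat{\mathcal P}_n(x;\zeta):=\{Q\in\mathcal P(\mathcal Y): d_{W,p}(Q,\hat P^{ER}_n(x))\le\zeta\}$. The ER-DRO problem is $\hat v^{DRO}_n(x)=\min_{z\in\mathcal Z}\sup_{Q\in\hat{\mathcal P}_n(x;\zeta)}\mathbb E_{Y\sim Q}[c(z,Y)]$,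 whose objective is assumed real-valued and lower semicontinuous on $\mathcal Z$ for each $x$; $\hat z^{DRO}_n(x)$ denotes an optimal solution. Radius. Let $C\ge1$, $c_0>0$ be the constants (depending only on $a$, $d_y$ and $\mathbb E[\exp(\|\varepsilon\|^a)]$) of the measure concentration inequality, quoted from the literature, $$\mathbb P\{d_{W,p}(P^*_n(x),P_{Y\mid X=x})\ge\kappa\}\le\begin{cases}C\exp(-c_0n\kappa^{\max\{d_y/p,2\}}),&\kappa\le1,\\ C\exp(-c_0n\kappa^{a/p}),&\kappa>1,\end{cases}$$ for all $\kappa>0$, $n\in\mathbb N$, $x\in\mathcal X$. Setting the right-hand side equal to $\alpha/2$ gives $$\kappa^{(2)}_{p,n}(\alpha):=\begin{cases}\big(\tfrac{\log(2C/\alpha)}{c_0n}\big)^{\min\{p/d_y,1/2\}},&n\ge\log(2C/\alpha)/c_0,\\ \big(\tfrac{\log(2C/\alpha)}{c_0n}\big)^{p/a},&n<\log(2C/\alpha)/c_0.\end{cases}$$ The radius is $\zeta_n(\alpha,x):=2\kappa_{p,n}(\alpha/4,x)+\kappa^{(2)}_{p,n}(\alpha)$. *)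

theory Defs
  imports "HOL-Probability.Probability"
begin

definition lsc_on :: "'a::topological_space set \<Rightarrow> ('a \<Rightarrow> real) \<Rightarrow> bool" where
  "lsc_on S f \<longleftrightarrow> (\<forall>x\<in>S. \<forall>b. b < f x \<longrightarrow> (\<forall>\<^sub>F y in at x within S. b < f y))"

definition law_support :: "'a::topological_space measure \<Rightarrow> 'a set" where
  "law_support P = {x. \<forall>U. open U \<and> x \<in> U \<longrightarrow> emeasure P U > 0}"

text \<open>The library's \<open>indep_var\<close> forces both random variables to have the same range type;
  this is independence of the two generated \<open>\<sigma>\<close>-algebras.\<close>
definition indep_rv ::
  "'s measure \<Rightarrow> ('s \<Rightarrow> 'a::topological_space) \<Rightarrow> ('s \<Rightarrow> 'b::topological_space) \<Rightarrow> bool" where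
  "indep_rv N X E \<longleftrightarrow>
     prob_space.indep_set N {X -` A \<inter> space N |A. A \<in> sets borel} {E -` B \<inter> space N |B. B \<in> sets borel}"

text \<open>\<open>f\<close> is a version of \<open>x \<mapsto> E[Y | X = x]\<close>: coordinatewise, \<open>f(X)\<close> is the conditional
  expectation of \<open>Y\<close> given the \<open>\<sigma>\<close>-algebra generated by \<open>X\<close>.\<close>
definition regression_function ::
  "'s measure \<Rightarrow> ('s \<Rightarrow> 'x::euclidean_space) \<Rightarrow> ('s \<Rightarrow> 'y::euclidean_space) \<Rightarrow> ('x \<Rightarrow> 'y) \<Rightarrow> bool" where
  "regression_function N X Y f \<longleftrightarrow>
     f \<in> borel_measurable borel \<and>
     (\<forall>b\<in>Basis. AE \<omega> in N.
        real_cond_exp N (vimage_algebra (space N) X borel) (\<lambda>\<omega>. Y \<omega> \<bullet> b) \<omega> = f (X \<omega>) \<bullet> b)"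

definition bounded_in_prob :: "'w measure \<Rightarrow> (nat \<Rightarrow> 'w \<Rightarrow> real) \<Rightarrow> bool" where
  "bounded_in_prob M R \<longleftrightarrow>
     (\<forall>n\<ge>1. R n \<in> borel_measurable M) \<and>
     (\<forall>\<delta>>0. \<exists>K. \<forall>n\<ge>1. \<P>(\<omega> in M. \<bar>R n \<omega>\<bar> > K) \<le> \<delta>)"

definition big_Op :: "'w measure \<Rightarrow> (nat \<Rightarrow> 'w \<Rightarrow> real) \<Rightarrow> (nat \<Rightarrow> 'w \<Rightarrow> real) \<Rightarrow> bool" where
  "big_Op M V W \<longleftrightarrow>
     (\<exists>R. bounded_in_prob M R \<and> (\<forall>n\<ge>1. \<forall>\<omega>\<in>space M. V n \<omega> = R n \<omega> * W n \<omega>))"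

definition couplings ::
  "'y::euclidean_space measure \<Rightarrow> 'y measure \<Rightarrow> ('y \<times> 'y) measure set" where
  "couplings Q1 Q2 =
     {\<pi>. sets \<pi> = sets (borel \<Otimes>\<^sub>M borel) \<and> distr \<pi> borel fst = Q1 \<and> distr \<pi> borel snd = Q2}"

definition transport_cost :: "real \<Rightarrow> 'y::euclidean_space measure \<Rightarrow> 'y measure \<Rightarrow> ennreal" where
  "transport_cost p Q1 Q2 =
     (INF \<pi>\<in>couplings Q1 Q2. \<integral>\<^sup>+ u. ennreal (norm (fst u - snd u) powr p) \<partial>\<pi>)"

text \<open>The \<open>p\<close>-th root of the transport cost; the value \<open>\<infinity>\<close> is kept, so that distributions
  at infinite distance lie in no ball.\<close>
definition wasserstein :: "real \<Rightarrow> 'y::euclidean_space measure \<Rightarrow> 'y measure \<Rightarrow> ennreal" where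
  "wasserstein p Q1 Q2 =
     (if transport_cost p Q1 Q2 = \<infinity> then \<infinity>
      else ennreal (enn2real (transport_cost p Q1 Q2) powr (1 / p)))"

text \<open>For \<open>n \<ge> 1\<close> this is \<open>(1/n) (\<delta>_(u 0) + \<dots> + \<delta>_(u (n - 1)))\<close>.\<close>
definition empirical :: "nat \<Rightarrow> (nat \<Rightarrow> 'y::euclidean_space) \<Rightarrow> 'y measure" where
  "empirical n u = distr (uniform_count_measure {..<n}) borel u"

text \<open>The cost \<open>c z\<close> is only meaningful on \<open>\<Y>\<close>; all laws integrated below are carried by \<open>\<Y>\<close>,
  and integrating over \<open>\<Y>\<close> makes the values of \<open>c z\<close> elsewhere irrelevant.\<close>
definition expected_cost ::
  "'y::euclidean_space set \<Rightarrow> ('z \<Rightarrow> 'y \<Rightarrow> real) \<Rightarrow> 'y measure \<Rightarrow> 'z \<Rightarrow> real" where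
  "expected_cost \<Y> c Q z = (LINT y:\<Y>|Q. c z y)"

definition cond_law ::
  "'s measure \<Rightarrow> ('s \<Rightarrow> 'y::euclidean_space) \<Rightarrow> ('x \<Rightarrow> 'y) \<Rightarrow> 'x \<Rightarrow> 'y measure" where
  "cond_law N \<epsilon> f x = distr N borel (\<lambda>\<omega>. f x + \<epsilon> \<omega>)"

definition ambiguity_set ::
  "real \<Rightarrow> 'y::euclidean_space set \<Rightarrow> 'y measure \<Rightarrow> real \<Rightarrow> 'y measure set" where
  "ambiguity_set p \<Y> P \<zeta> =
     {Q. prob_space Q \<and> sets Q = sets borel \<and> emeasure Q \<Y> = 1 \<and> wasserstein p Q P \<le> ennreal \<zeta>}"

definition dro_objective ::
  "real \<Rightarrow> 'y::euclidean_space set \<Rightarrow> ('z \<Rightarrow> 'y \<Rightarrow> real) \<Rightarrow> 'y measure \<Rightarrow> real \<Rightarrow> 'z \<Rightarrow> real" where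
  "dro_objective p \<Y> c P \<zeta> z = (SUP Q\<in>ambiguity_set p \<Y> P \<zeta>. expected_cost \<Y> c Q z)"

text \<open>\<open>ys i\<close>, \<open>xs i\<close> for \<open>i < n\<close> are the first \<open>n\<close> observations.\<close>
definition data :: "(nat \<Rightarrow> 'w \<Rightarrow> 'y) \<Rightarrow> (nat \<Rightarrow> 'w \<Rightarrow> 'x) \<Rightarrow> nat \<Rightarrow> 'w \<Rightarrow> nat \<Rightarrow> 'y \<times> 'x" where
  "data ys xs n \<omega> = (\<lambda>i\<in>{..<n}. (ys i \<omega>, xs i \<omega>))"

definition error_empirical ::
  "('x \<Rightarrow> 'y::euclidean_space) \<Rightarrow> (nat \<Rightarrow> 'w \<Rightarrow> 'y) \<Rightarrow> (nat \<Rightarrow> 'w \<Rightarrow> 'x) \<Rightarrow> nat \<Rightarrow> 'w \<Rightarrow> 'x \<Rightarrow> 'y measure" where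
  "error_empirical f ys xs n \<omega> x = empirical n (\<lambda>i. f x + (ys i \<omega> - f (xs i \<omega>)))"

definition residual_empirical ::
  "'y set \<Rightarrow> (nat \<Rightarrow> 'w \<Rightarrow> 'x \<Rightarrow> 'y::euclidean_space) \<Rightarrow> (nat \<Rightarrow> 'w \<Rightarrow> 'y) \<Rightarrow> (nat \<Rightarrow> 'w \<Rightarrow> 'x) \<Rightarrow>
   nat \<Rightarrow> 'w \<Rightarrow> 'x \<Rightarrow> 'y measure" where
  "residual_empirical \<Y> fhat ys xs n \<omega> x =
     empirical n (\<lambda>i. closest_point \<Y> (fhat n \<omega> x + (ys i \<omega> - fhat n \<omega> (xs i \<omega>))))"

text \<open>\<open>d\<close> is the dimension of the range of \<open>Y\<close>.\<close>
definition concentration_bound ::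
  "nat \<Rightarrow> real \<Rightarrow> real \<Rightarrow> real \<Rightarrow> real \<Rightarrow> nat \<Rightarrow> real \<Rightarrow> real" where
  "concentration_bound d p a C c0 n k =
     (if k \<le> 1 then C * exp (- c0 * real n * k powr max (real d / p) 2)
      else C * exp (- c0 * real n * k powr (a / p)))"

text \<open>The radius at which \<open>concentration_bound\<close> equals \<open>\<alpha> / 2\<close>.\<close>
definition kappa2 :: "nat \<Rightarrow> real \<Rightarrow> real \<Rightarrow> real \<Rightarrow> real \<Rightarrow> nat \<Rightarrow> real \<Rightarrow> real" where
  "kappa2 d p a C c0 n \<alpha> =
     (if real n \<ge> ln (2 * C / \<alpha>) / c0
      then (ln (2 * C / \<alpha>) / (c0 * real n)) powr min (p / real d) (1 / 2)
      else (ln (2 * C / \<alpha>) / (c0 * real n)) powr (p / a))"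

definition radius ::
  "nat \<Rightarrow> real \<Rightarrow> real \<Rightarrow> real \<Rightarrow> real \<Rightarrow> (nat \<Rightarrow> real \<Rightarrow> 'x \<Rightarrow> real) \<Rightarrow> nat \<Rightarrow> real \<Rightarrow> 'x \<Rightarrow> real" where
  "radius d p a C c0 \<kappa> n \<alpha> x = 2 * \<kappa> n (\<alpha> / 4) x + kappa2 d p a C c0 n \<alpha>"

end

theory Submission
  imports Defs
begin

text \<open>
  With probability at least \<open>1 - \<alpha> n\<close> the law \<open>P\<close> of \<open>f x + \<epsilon>\<close> lies in the ambiguity set. Indeed the
  projection onto \<open>\<Y>\<close> is nonexpansive and fixes the (almost surely \<open>\<Y>\<close>-valued) points
  \<open>f x + \<epsilon>\<^sub>i\<close>, so the residual measure is within \<open>2 \<kappa>\<close> of their empirical measure, which is within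
  \<open>kappa2\<close> of \<open>P\<close>.
  On this event, \<open>v* \<le> g zhat \<le> vDRO \<le> obj z0\<close> for a minimizer \<open>z0\<close> of the lower semicontinuous \<open>g\<close>,
  and it remains to bound \<open>obj z0 - g z0\<close> by a multiple of the radius.

  Both smoothness alternatives give
  \<open>\<bar>c y1 - c y2\<bar> \<le> (K + L * norm y2 + L * norm (y1 - y2)) * norm (y1 - y2)\<close> with \<open>L = 0\<close> unless
  \<open>p \<ge> 2\<close>. Integrated against a coupling of transport cost at most \<open>r powr p\<close>, this is \<open>O(r)\<close> as soon as
  \<open>L * (norm y2)\<^sup>2\<close> is integrable, so the comparison of a member of the ambiguity set with \<open>P\<close> can pass
  through the residual measure. The constants depend on \<open>z0\<close>, hence on \<open>x\<close>; the exponential moment of \<open>\<epsilon>\<close>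
  provides the needed integrability for every \<open>z\<close> at once, because the hypotheses that hold only for
  almost every \<open>x\<close> at each fixed \<open>z\<close> cannot be applied to \<open>z0\<close>.

  Since \<open>\<alpha> n\<close> tends to 0 and a single random variable is tight, the bound off events of probability
  \<open>\<alpha> n\<close> is a bound in probability.
\<close>

subsection \<open>Minkowski inequality, semicontinuity and tightness\<close>

text \<open>At positive points this is convexity of the power; when an argument vanishes, it reduces
  to \<open>s powr p \<le> s\<close> on the unit interval.\<close>

lemma powr_convex_nonneg:
  fixes x y \<theta> p :: real
  assumes "1 \<le> p" "0 \<le> x" "0 \<le> y" "0 \<le> \<theta>" "\<theta> \<le> 1"
  shows "(\<theta> * x + (1 - \<theta>) * y) powr p \<le> \<theta> * x powr p + (1 - \<theta>) * y powr p"
proof -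
  have scale: "(s * t) powr p \<le> s * t powr p" if "0 \<le> s" "s \<le> 1" "0 \<le> t" for s t :: real
  proof -
    have "s powr p \<le> s"
      using powr_mono'[of 1 p s] that assms(1) by simp
    then show ?thesis
      using that by (simp add: powr_mult mult_right_mono)
  qed
  consider "x = 0" | "y = 0" | "x > 0" "y > 0"
    using assms by linarith
  then show ?thesis
  proof cases
    case 1
    then show ?thesis using scale[of "1 - \<theta>" y] assms by simp
  next
    case 2
    then show ?thesis using scale[of \<theta> x] assms by simp
  next
    case 3
    then show ?thesis
      using convex_onD[OF powr_convex[OF assms(1)], of "1 - \<theta>" x y] assms by simp
  qed
qed

lemma square_le_one_plus_powr:
  fixes x p :: real
  assumes "2 \<le> p" "0 \<le> x"
  shows "x\<^sup>2 \<le> 1 + x powr p"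
proof (cases "x \<le> 1")
  case True
  then have "x\<^sup>2 \<le> 1" using assms by (simp add: power_le_one)
  then show ?thesis using powr_ge_zero[of x p] by linarith
next
  case False
  then show ?thesis using powr_mono[of 2 p x] assms by (simp add: powr_numeral)
qed

text \<open>Convexity is applied to the normalized values \<open>s / A\<close> and
  \<open>t / B\<close> with weights proportional to \<open>A\<close> and \<open>B\<close>. The
  coefficients are such that replacing \<open>s\<close> by \<open>A\<close> and \<open>t\<close> by
  \<open>B\<close> turns the right-hand side into \<open>(A + B) powr p\<close>.\<close>

lemma powr_add_le_weighted:
  fixes s t A B p :: real
  assumes "1 \<le> p" "0 \<le> s" "0 \<le> t" "0 < A" "0 < B"
  shows "(s + t) powr p \<le>
    (A + B) powr p * (A / (A + B)) / A powr p * s powr p + (A + B) powr p * (B / (A + B)) / B powr p * t powr p"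
proof -
  define \<theta> where "\<theta> = A / (A + B)"
  have \<theta>: "0 \<le> \<theta>" "\<theta> \<le> 1" "1 - \<theta> = B / (A + B)"
    using assms by (auto simp: \<theta>_def field_simps)
  have "s + t = (A + B) * (\<theta> * (s / A) + (1 - \<theta>) * (t / B))"
  proof -
    have "\<theta> * (s / A) = s / (A + B)" "(1 - \<theta>) * (t / B) = t / (A + B)"
      unfolding \<theta>(3) unfolding \<theta>_def using assms by simp_all
    then show ?thesis
      using assms by (simp add: add_divide_distrib[symmetric])
  qed
  then have "(s + t) powr p = (A + B) powr p * (\<theta> * (s / A) + (1 - \<theta>) * (t / B)) powr p"
    using assms \<theta> by (simp add: powr_mult)
  also have "\<dots> \<le> (A + B) powr p * (\<theta> * (s / A) powr p + (1 - \<theta>) * (t / B) powr p)"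
    using assms \<theta> by (intro mult_left_mono powr_convex_nonneg) auto
  also have "\<dots> = (A + B) powr p * (A / (A + B)) / A powr p * s powr p + (A + B) powr p * (B / (A + B)) / B powr p * t powr p"
    using assms unfolding \<theta>(3) unfolding \<theta>_def by (simp add: powr_divide algebra_simps)
  finally show ?thesis .
qed

text \<open>Minkowski's inequality, phrased with positive upper bounds for the two norms so that the
  pointwise weighted inequality only has to be integrated; vanishing norms then need no separate
  case.\<close>

lemma nn_integral_powr_add_le:
  fixes s t :: "'a \<Rightarrow> real" and A B p :: real
  assumes "1 \<le> p" "0 < A" "0 < B"
    and [measurable]: "s \<in> borel_measurable M" "t \<in> borel_measurable M"
    and "\<And>x. 0 \<le> s x" "\<And>x. 0 \<le> t x"
    and s: "(\<integral>\<^sup>+x. ennreal (s x powr p) \<partial>M) \<le> ennreal (A powr p)"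
    and t: "(\<integral>\<^sup>+x. ennreal (t x powr p) \<partial>M) \<le> ennreal (B powr p)"
  shows "(\<integral>\<^sup>+x. ennreal ((s x + t x) powr p) \<partial>M) \<le> ennreal ((A + B) powr p)"
proof -
  define a where "a = (A + B) powr p * (A / (A + B)) / A powr p"
  define b where "b = (A + B) powr p * (B / (A + B)) / B powr p"
  have ab: "0 \<le> a" "0 \<le> b"
    using assms by (auto simp: a_def b_def)
  have le: "(s x + t x) powr p \<le> a * s x powr p + b * t x powr p" for x
    unfolding a_def b_def using assms by (intro powr_add_le_weighted) auto
  have "(\<integral>\<^sup>+x. ennreal ((s x + t x) powr p) \<partial>M)
      \<le> (\<integral>\<^sup>+x. ennreal a * ennreal (s x powr p) + ennreal b * ennreal (t x powr p) \<partial>M)"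
    using le ab
    by (intro nn_integral_mono)
       (simp add: ennreal_mult[symmetric] ennreal_plus[symmetric] ennreal_leI del: ennreal_plus)
  also have "\<dots> = ennreal a * (\<integral>\<^sup>+x. ennreal (s x powr p) \<partial>M) + ennreal b * (\<integral>\<^sup>+x. ennreal (t x powr p) \<partial>M)"
    by (simp add: nn_integral_add nn_integral_cmult)
  also have "\<dots> \<le> ennreal a * ennreal (A powr p) + ennreal b * ennreal (B powr p)"
    by (intro add_mono mult_left_mono s t) auto
  also have "\<dots> = ennreal (a * A powr p + b * B powr p)"
    using ab by (simp add: ennreal_mult)
  also have "a * A powr p + b * B powr p = (A + B) powr p * (A / (A + B) + B / (A + B))"
    using assms by (simp add: a_def b_def distrib_left)
  also have "A / (A + B) + B / (A + B) = 1"
    using assms by (simp add: add_divide_distrib[symmetric])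
  finally show ?thesis by simp
qed

section \<open>Lower semicontinuous functions\<close>

lemma lsc_on_openin_superlevel:
  assumes "lsc_on S f"
  shows "\<exists>U. open U \<and> S \<inter> U = {z\<in>S. b < f z}"
proof (intro exI conjI)
  let ?U = "\<Union>{U. open U \<and> (\<forall>y\<in>S \<inter> U. b < f y)}"
  show "open ?U"
    by (rule open_Union) simp
  show "S \<inter> ?U = {z\<in>S. b < f z}"
  proof
    show "S \<inter> ?U \<subseteq> {z\<in>S. b < f z}" by auto
    show "{z\<in>S. b < f z} \<subseteq> S \<inter> ?U"
    proof
      fix z assume "z \<in> {z\<in>S. b < f z}"
      then have z: "z \<in> S" "b < f z" by auto
      have "\<forall>\<^sub>F y in at z within S. b < f y"
        using assms z by (auto simp: lsc_on_def)
      then obtain U where U: "open U" "z \<in> U" "\<forall>y\<in>U. y \<noteq> z \<longrightarrow> y \<in> S \<longrightarrow> b < f y"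
        unfolding eventually_at_topological by blast
      \<comment> \<open>The filter \<open>at z within S\<close> says nothing about \<open>z\<close>
        itself, where the inequality holds by the choice of \<open>z\<close>.\<close>
      have "\<forall>y\<in>S \<inter> U. b < f y"
      proof
        fix y assume "y \<in> S \<inter> U"
        then show "b < f y" using U(3) z by (cases "y = z") auto
      qed
      then show "z \<in> S \<inter> ?U" using U z by auto
    qed
  qed
qed

text \<open>If no point were a minimizer, the relatively open sets where \<open>f\<close> exceeds
  \<open>f y\<close>, for \<open>y\<close> in \<open>S\<close>, would cover \<open>S\<close>. A
  finite subcover is indexed by a finite set \<open>D\<close>, and the point of \<open>D\<close>
  with the least value of \<open>f\<close> would be covered by none of its members.\<close>

lemma lsc_on_attains_min:
  fixes f :: "'a::topological_space \<Rightarrow> real"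
  assumes "compact S" "S \<noteq> {}" "lsc_on S f"
  obtains z where "z \<in> S" "\<And>y. y \<in> S \<Longrightarrow> f z \<le> f y"
proof (rule ccontr)
  assume "\<not> thesis"
  then have ex: "\<exists>y\<in>S. f y < f z" if "z \<in> S" for z
    using that \<open>\<And>z. z \<in> S \<Longrightarrow> (\<And>y. y \<in> S \<Longrightarrow> f z \<le> f y) \<Longrightarrow> thesis\<close> by (meson not_le)
  have "\<exists>U. open U \<and> S \<inter> U = {z\<in>S. b < f z}" for b
    by (rule lsc_on_openin_superlevel[OF assms(3)])
  then obtain U where "\<forall>b. open (U b) \<and> S \<inter> U b = {z\<in>S. b < f z}"
    using choice[of "\<lambda>b U. open U \<and> S \<inter> U = {z\<in>S. b < f z}"] by blast
  then have U: "\<And>b. open (U b)" "\<And>b. S \<inter> U b = {z\<in>S. b < f z}"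
    by blast+
  have "S \<subseteq> (\<Union>y\<in>S. U (f y))"
    using ex U(2) by blast
  then obtain D where D: "D \<subseteq> S" "finite D" "S \<subseteq> (\<Union>y\<in>D. U (f y))"
    using compactE_image[OF assms(1), of S "\<lambda>y. U (f y)"] U(1) by blast
  then have "D \<noteq> {}" using assms(2) by auto
  define y where "y = arg_min_on f D"
  have y: "y \<in> D" "\<And>y'. y' \<in> D \<Longrightarrow> f y \<le> f y'"
    using arg_min_least[OF D(2) \<open>D \<noteq> {}\<close>, of _ f] arg_min_if_finite(1)[OF D(2) \<open>D \<noteq> {}\<close>, of f]
    by (auto simp: y_def)
  then obtain y' where "y' \<in> D" "y \<in> U (f y')"
    using D by blast
  then show False
    using U(2)[of "f y'"] y D by (metis (mono_tags, lifting) IntI mem_Collect_eq not_le subsetD)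
qed

text \<open>Superlevel sets are relatively open. This makes the true cost of a random solution a
  random variable.\<close>

lemma lsc_on_borel_measurable:
  fixes f :: "'a::topological_space \<Rightarrow> real"
  assumes "lsc_on S f"
  shows "f \<in> borel_measurable (restrict_space borel S)"
proof -
  have "{z \<in> space (restrict_space borel S). b < f z} \<in> sets (restrict_space borel S)" for b
  proof -
    obtain U where "open U" "S \<inter> U = {z\<in>S. b < f z}"
      using lsc_on_openin_superlevel[OF assms, of b] by blast
    moreover have "{z \<in> space (restrict_space borel S). b < f z} = {z\<in>S. b < f z}"
      by (auto simp: space_restrict_space)
    ultimately show ?thesis
      by (metis borel_open imageI sets_restrict_space)
  qed
  then show ?thesis
    by (simp add: borel_measurable_iff_greater)
qed

section \<open>Supports of laws\<close>

lemma closed_law_support: "closed (law_support P)"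
proof -
  have "- law_support P = \<Union>{U. open U \<and> emeasure P U = 0}"
    by (auto simp: law_support_def not_gr_zero)
  moreover have "open (\<Union>{U. open U \<and> emeasure P U = 0})"
    by (rule open_Union) simp
  ultimately show ?thesis
    unfolding closed_def by (rule ssubst)
qed

text \<open>Every point outside the support has a null basic open neighbourhood, and by second
  countability there are only countably many of these.\<close>

lemma AE_in_law_support:
  fixes P :: "'a::second_countable_topology measure"
  assumes "sets P = sets borel"
  shows "AE x in P. x \<in> law_support P"
proof -
  obtain B :: "'a set set" where B: "countable B" "topological_basis B"
    using ex_countable_basis by blast
  have meas: "U \<in> sets P" if "open U" for U
    using that assms by simp
  have "(\<Union>U\<in>{U\<in>B. emeasure P U = 0}. U) \<in> null_sets P"
    using B by (intro null_sets_UN') (auto intro!: null_setsI meas simp: topological_basis_open)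
  moreover have "{x\<in>space P. x \<notin> law_support P} \<subseteq> (\<Union>U\<in>{U\<in>B. emeasure P U = 0}. U)"
  proof
    fix x assume "x \<in> {x\<in>space P. x \<notin> law_support P}"
    then obtain U where U: "open U" "x \<in> U" "emeasure P U = 0"
      by (auto simp: law_support_def not_gr_zero)
    then obtain V where V: "V \<in> B" "x \<in> V" "V \<subseteq> U"
      using B(2) by (meson topological_basisE)
    then have "emeasure P V \<le> emeasure P U"
      using meas U by (intro emeasure_mono) auto
    then show "x \<in> (\<Union>U\<in>{U\<in>B. emeasure P U = 0}. U)"
      using V U by auto
  qed
  ultimately show ?thesis
    by (rule AE_I')
qed

section \<open>Tightness\<close>

lemma (in prob_space) ex_prob_abs_gt_le:
  fixes R :: "'a \<Rightarrow> real"
  assumes [measurable]: "R \<in> borel_measurable M" and "0 < \<delta>"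
  shows "\<exists>K. prob {\<omega>\<in>space M. \<bar>R \<omega>\<bar> > K} \<le> \<delta>"
proof -
  \<comment> \<open>Continuity from above: the events decrease to the empty set because
    \<open>R\<close> is real-valued.\<close>
  have "(\<lambda>k. prob {\<omega>\<in>space M. \<bar>R \<omega>\<bar> > real k}) \<longlonglongrightarrow> prob (\<Inter>k. {\<omega>\<in>space M. \<bar>R \<omega>\<bar> > real k})"
    by (intro finite_Lim_measure_decseq) (auto simp: decseq_def)
  also have "(\<Inter>k. {\<omega>\<in>space M. \<bar>R \<omega>\<bar> > real k}) = {}"
  proof -
    have "\<exists>k. \<not> real k < \<bar>R \<omega>\<bar>" for \<omega>
      using real_arch_simple[of "\<bar>R \<omega>\<bar>"] by (auto simp: not_less)
    then show ?thesis by auto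
  qed
  finally have "\<forall>\<^sub>F k in sequentially. prob {\<omega>\<in>space M. \<bar>R \<omega>\<bar> > real k} < \<delta>"
    using assms(2) by (intro order_tendstoD(2)) auto
  then show ?thesis
    by (auto simp: eventually_sequentially intro: less_imp_le)
qed

text \<open>One constant \<open>K\<close> works for all \<open>n\<close> with
  \<open>\<beta> n < \<delta>\<close>. The finitely many remaining indices each have their own
  constant by tightness of a single variable, and the maximum serves for all.\<close>

lemma bounded_in_probI:
  fixes R :: "nat \<Rightarrow> 'a \<Rightarrow> real"
  assumes "prob_space M"
    and meas: "\<And>n. n \<ge> 1 \<Longrightarrow> R n \<in> borel_measurable M"
    and "\<beta> \<longlonglongrightarrow> 0"
    and bound: "\<And>n. n \<ge> 1 \<Longrightarrow> \<P>(\<omega> in M. \<bar>R n \<omega>\<bar> > K) \<le> \<beta> n"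
  shows "bounded_in_prob M R"
  unfolding bounded_in_prob_def
proof (intro conjI allI impI meas)
  interpret prob_space M by fact
  fix \<delta> :: real assume "0 < \<delta>"
  obtain n0 where n0: "\<And>n. n \<ge> n0 \<Longrightarrow> \<beta> n < \<delta>"
    using order_tendstoD(2)[OF assms(3) \<open>0 < \<delta>\<close>] by (auto simp: eventually_sequentially)
  have "\<exists>k. \<forall>n. n \<ge> 1 \<longrightarrow> prob {\<omega>\<in>space M. \<bar>R n \<omega>\<bar> > k n} \<le> \<delta>"
    using ex_prob_abs_gt_le[OF meas \<open>0 < \<delta>\<close>] by (intro choice) blast
  then obtain k where k: "\<And>n. n \<ge> 1 \<Longrightarrow> prob {\<omega>\<in>space M. \<bar>R n \<omega>\<bar> > k n} \<le> \<delta>"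
    by blast
  define K' where "K' = Max (insert K (k ` {..<n0}))"
  have mono: "prob {\<omega>\<in>space M. \<bar>R n \<omega>\<bar> > K'} \<le> prob {\<omega>\<in>space M. \<bar>R n \<omega>\<bar> > k'}"
    if "n \<ge> 1" "k' \<le> K'" for n k'
  proof -
    have [measurable]: "R n \<in> borel_measurable M" using meas that by simp
    show ?thesis using that by (intro finite_measure_mono) auto
  qed
  have "prob {\<omega>\<in>space M. \<bar>R n \<omega>\<bar> > K'} \<le> \<delta>" if n: "n \<ge> 1" for n
  proof (cases "n < n0")
    case True
    then have "k n \<le> K'" by (auto simp: K'_def)
    then show ?thesis using mono[OF n] k[OF n] by (meson order_trans)
  next
    case False
    have "K \<le> K'" by (auto simp: K'_def)
    then show ?thesis using mono[OF n] bound[OF n] n0[of n] False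
      by (meson order_trans less_imp_le not_less)
  qed
  then show "\<exists>K. \<forall>n\<ge>1. prob {\<omega>\<in>space M. \<bar>R n \<omega>\<bar> > K} \<le> \<delta>" by blast
qed

section \<open>The concentration radius\<close>

lemma kappa2_pos:
  assumes "0 < c0" "1 \<le> C" "0 < \<alpha>" "\<alpha> < 1" "n \<ge> 1"
  shows "kappa2 d p a C c0 n \<alpha> > 0"
proof -
  have "ln (2 * C / \<alpha>) > 0"
    using assms by (intro ln_gt_zero) (simp add: field_simps)
  then show ?thesis
    using assms by (simp add: kappa2_def)
qed

text \<open>The branches of the two definitions correspond: raising \<open>q\<close> to a positive
  power does not change its position relative to 1, and \<open>n \<ge> L / c0\<close> means
  \<open>q \<le> 1\<close>. In each branch the two exponents are reciprocal, so the exponential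
  always receives \<open>q\<close> itself.\<close>

lemma concentration_bound_kappa2:
  assumes "0 < c0" "1 \<le> C" "0 < \<alpha>" "\<alpha> < 1" "n \<ge> 1" "0 < p" "0 < a" "0 < d"
  shows "concentration_bound d p a C c0 n (kappa2 d p a C c0 n \<alpha>) = \<alpha> / 2"
proof -
  define L where "L = ln (2 * C / \<alpha>)"
  define q where "q = L / (c0 * real n)"
  have "L > 0"
    unfolding L_def using assms by (intro ln_gt_zero) (simp add: field_simps)
  then have q: "q > 0" using assms by (simp add: q_def)
  have fin: "C * exp (- c0 * real n * q) = \<alpha> / 2"
  proof -
    have "- c0 * real n * q = - L" using assms by (simp add: q_def)
    then have "C * exp (- c0 * real n * q) = C / exp L" by (simp add: exp_minus field_simps)
    also have "exp L = 2 * C / \<alpha>" unfolding L_def using assms by simp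
    finally show ?thesis using assms by simp
  qed
  show ?thesis
  proof (cases "real n \<ge> L / c0")
    case True
    define e where "e = min (p / real d) (1 / 2)"
    have e: "e > 0" "e * max (real d / p) 2 = 1"
      using assms by (auto simp: e_def min_def max_def field_simps)
    have "q \<le> 1" using True assms by (simp add: q_def field_simps)
    then have "q powr e \<le> 1" using q e powr_mono2[of e q 1] by simp
    moreover have "kappa2 d p a C c0 n \<alpha> = q powr e"
      using True by (simp add: kappa2_def L_def q_def e_def)
    moreover have "(q powr e) powr max (real d / p) 2 = q"
      using q e by (simp add: powr_powr)
    ultimately show ?thesis using fin by (simp add: concentration_bound_def)
  next
    case False
    have "q > 1" using False assms by (simp add: q_def field_simps)
    then have "q powr (p / a) > 1" using assms powr_less_mono2[of "p / a" 1 q] by simp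
    moreover have "kappa2 d p a C c0 n \<alpha> = q powr (p / a)"
      using False by (simp add: kappa2_def L_def q_def)
    moreover have "(q powr (p / a)) powr (a / p) = q"
      using q assms by (simp add: powr_powr)
    ultimately show ?thesis using fin by (simp add: concentration_bound_def)
  qed
qed

subsection \<open>Transport cost to an empirical measure\<close>

lemma couplingsD:
  assumes "\<pi> \<in> couplings Q1 Q2"
  shows "sets \<pi> = sets borel" "sets \<pi> = sets (borel \<Otimes>\<^sub>M borel)"
    "distr \<pi> borel fst = Q1" "distr \<pi> borel snd = Q2"
proof -
  show s: "sets \<pi> = sets (borel \<Otimes>\<^sub>M borel)" "distr \<pi> borel fst = Q1" "distr \<pi> borel snd = Q2"
    using assms by (auto simp: couplings_def)
  show "sets \<pi> = sets borel"
    using s(1) unfolding borel_prod .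
qed

lemma coupling_prob_space:
  assumes "\<pi> \<in> couplings Q1 Q2" "prob_space Q2"
  shows "prob_space \<pi>"
proof (rule prob_space_distrD)
  show "snd \<in> \<pi> \<rightarrow>\<^sub>M borel"
    using couplingsD(2)[OF assms(1)] measurable_cong_sets by fastforce
  show "prob_space (distr \<pi> borel snd)"
    using assms couplingsD(4) by blast
qed

text \<open>Symmetry of transport. Couplings are built from the residual measure to the true law,
  whereas membership in the ambiguity set asks for the opposite direction.\<close>

lemma coupling_swap:
  assumes "\<pi> \<in> couplings Q1 Q2"
  shows "distr \<pi> (borel \<Otimes>\<^sub>M borel) prod.swap \<in> couplings Q2 Q1"
    and "(\<integral>\<^sup>+ u. ennreal (norm (fst u - snd u) powr p) \<partial>distr \<pi> (borel \<Otimes>\<^sub>M borel) prod.swap)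
       = (\<integral>\<^sup>+ u. ennreal (norm (fst u - snd u) powr p) \<partial>\<pi>)"
proof -
  note [measurable_cong] = couplingsD(2)[OF assms]
  have [measurable]: "prod.swap \<in> \<pi> \<rightarrow>\<^sub>M (borel \<Otimes>\<^sub>M borel)"
    by (simp add: prod.swap_def[abs_def])
  show "distr \<pi> (borel \<Otimes>\<^sub>M borel) prod.swap \<in> couplings Q2 Q1"
    using couplingsD(3,4)[OF assms] by (simp add: couplings_def distr_distr comp_def)
  show "(\<integral>\<^sup>+ u. ennreal (norm (fst u - snd u) powr p) \<partial>distr \<pi> (borel \<Otimes>\<^sub>M borel) prod.swap)
       = (\<integral>\<^sup>+ u. ennreal (norm (fst u - snd u) powr p) \<partial>\<pi>)"
    by (subst nn_integral_distr) (auto simp: norm_minus_commute)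
qed

text \<open>Removes the root and the case of infinite cost, so that later arguments deal with
  transport costs only.\<close>

lemma wasserstein_le_iff:
  assumes "0 < p" "0 \<le> r"
  shows "wasserstein p Q1 Q2 \<le> ennreal r \<longleftrightarrow> transport_cost p Q1 Q2 \<le> ennreal (r powr p)"
    and "wasserstein p Q1 Q2 < ennreal r \<longleftrightarrow> transport_cost p Q1 Q2 < ennreal (r powr p)"
proof -
  have powr_less: "t powr (1 / p) < r \<longleftrightarrow> t < r powr p" if "0 \<le> t" for t
  proof
    assume "t powr (1 / p) < r"
    then have "(t powr (1 / p)) powr p < r powr p"
      using assms by (intro powr_less_mono2) auto
    then show "t < r powr p" using assms that by (simp add: powr_powr)
  next
    assume "t < r powr p"
    then have "t powr (1 / p) < (r powr p) powr (1 / p)"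
      using assms that by (intro powr_less_mono2) auto
    then show "t powr (1 / p) < r" using assms by (simp add: powr_powr)
  qed
  have powr_le: "t powr (1 / p) \<le> r \<longleftrightarrow> t \<le> r powr p" if "0 \<le> t" for t
  proof
    assume "t powr (1 / p) \<le> r"
    then have "(t powr (1 / p)) powr p \<le> r powr p"
      using assms by (intro powr_mono2) auto
    then show "t \<le> r powr p" using assms that by (simp add: powr_powr)
  next
    assume "t \<le> r powr p"
    then have "t powr (1 / p) \<le> (r powr p) powr (1 / p)"
      using assms that by (intro powr_mono2) auto
    then show "t powr (1 / p) \<le> r" using assms by (simp add: powr_powr)
  qed
  show "wasserstein p Q1 Q2 \<le> ennreal r \<longleftrightarrow> transport_cost p Q1 Q2 \<le> ennreal (r powr p)"
    using assms by (cases "transport_cost p Q1 Q2") (auto simp: wasserstein_def powr_le top_unique)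
  show "wasserstein p Q1 Q2 < ennreal r \<longleftrightarrow> transport_cost p Q1 Q2 < ennreal (r powr p)"
    using assms by (cases "transport_cost p Q1 Q2") (auto simp: wasserstein_def powr_less ennreal_less_iff)
qed

text \<open>The strict inequality is what produces a coupling: the infimum has not been shown to be
  attained.\<close>

lemma wasserstein_less_imp_coupling:
  assumes "0 < p" "0 \<le> r" "wasserstein p Q1 Q2 < ennreal r"
  obtains \<pi> where "\<pi> \<in> couplings Q1 Q2"
    "(\<integral>\<^sup>+ u. ennreal (norm (fst u - snd u) powr p) \<partial>\<pi>) \<le> ennreal (r powr p)"
  using assms(3) unfolding wasserstein_le_iff(2)[OF assms(1,2)] transport_cost_def INF_less_iff
  by (auto intro: less_imp_le)

lemma wasserstein_leI:
  assumes "0 < p" "0 \<le> r" "\<pi> \<in> couplings Q1 Q2"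
    "(\<integral>\<^sup>+ u. ennreal (norm (fst u - snd u) powr p) \<partial>\<pi>) \<le> ennreal (r powr p)"
  shows "wasserstein p Q1 Q2 \<le> ennreal r"
  unfolding wasserstein_le_iff(1)[OF assms(1,2)] transport_cost_def
  using assms(3,4) by (rule INF_lower2)

section \<open>Empirical measures\<close>

lemma sets_empirical [simp, measurable_cong]: "sets (empirical n u) = sets borel"
  by (simp add: empirical_def)

lemma measurable_uniform_count [measurable]: "u \<in> uniform_count_measure {..<n} \<rightarrow>\<^sub>M borel"
  by (auto simp: measurable_def space_uniform_count_measure sets_uniform_count_measure)

lemma prob_space_empirical: "n \<ge> 1 \<Longrightarrow> prob_space (empirical n u)"
  unfolding empirical_def
  by (intro prob_space.prob_space_distr prob_space_uniform_count_measure) (auto simp: lessThan_empty_iff)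

lemma nn_integral_empirical:
  assumes [measurable]: "h \<in> borel_measurable borel"
  shows "(\<integral>\<^sup>+ y. h y \<partial>empirical n u) = (\<Sum>i<n. ennreal (1 / real n) * h (u i))"
  unfolding empirical_def
  by (subst nn_integral_distr) (auto simp: uniform_count_measure_def nn_integral_point_measure_finite)

lemma AE_empirical:
  assumes "\<And>i. i < n \<Longrightarrow> P (u i)" "Measurable.pred borel P"
  shows "AE y in empirical n u. P y"
  unfolding empirical_def using assms
  by (subst AE_distr_iff) (auto simp: space_uniform_count_measure intro!: AE_I2)

text \<open>Gluing along the empirical middle measure: the mass that \<open>\<pi>\<close> puts on the fibre over an atom
  is divided equally among the indices \<open>i\<close> carrying that atom, and the \<open>i\<close>-th share is sent to \<open>w i\<close>.\<close>
lemma coupling_shift_empirical: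
  fixes u w :: "nat \<Rightarrow> 'y::euclidean_space"
  assumes n: "n \<ge> 1" and p: "1 \<le> p" and r: "0 < r" and s: "0 < s"
    and \<pi>: "\<pi> \<in> couplings (empirical n u) Q"
    and cost: "(\<integral>\<^sup>+ q. ennreal (norm (fst q - snd q) powr p) \<partial>\<pi>) \<le> ennreal (r powr p)"
    and shift: "1 / real n * (\<Sum>i<n. norm (w i - u i) powr p) \<le> s powr p"
  obtains \<pi>' where "\<pi>' \<in> couplings (empirical n w) Q"
    "(\<integral>\<^sup>+ q. ennreal (norm (fst q - snd q) powr p) \<partial>\<pi>') \<le> ennreal ((s + r) powr p)"
proof -
  note [measurable_cong] = couplingsD(2)[OF \<pi>]
  have \<pi>1: "distr \<pi> borel fst = empirical n u" and \<pi>2: "distr \<pi> borel snd = Q"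
    using couplingsD[OF \<pi>] by auto
  interpret prob_space \<pi>
  proof (rule prob_space_distrD)
    show "fst \<in> \<pi> \<rightarrow>\<^sub>M borel" by measurable
    show "prob_space (distr \<pi> borel fst)" unfolding \<pi>1 using n by (rule prob_space_empirical)
  qed
  define N where "N v = card {j. j < n \<and> u j = v}" for v
  \<comment> \<open>The conditional probability of the index \<open>i\<close> given the atom
    \<open>v\<close>: uniform over the \<open>N v\<close> indices that carry
    \<open>v\<close>.\<close>
  define \<theta> where "\<theta> v i = (if v = u i then ennreal (1 / real (N (u i))) else 0)" for v i
  have [measurable]: "(\<lambda>v. \<theta> v i) \<in> borel_measurable borel" for i
    unfolding \<theta>_def by measurable
  have N_pos: "N (u i) > 0" if "i < n" for i
    using that by (auto simp: N_def card_gt_0_iff)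
  have count: "(\<Sum>i<n. if v = u i then ennreal (1 / real (N v)) else 0) = 1" if "v \<in> u ` {..<n}" for v
  proof -
    have "(\<Sum>i<n. if v = u i then ennreal (1 / real (N v)) else 0)
        = (\<Sum>i\<in>{i\<in>{..<n}. v = u i}. ennreal (1 / real (N v)))"
      by (rule sum.inter_filter[symmetric]) simp
    also have "{i\<in>{..<n}. v = u i} = {i. i < n \<and> u i = v}"
      by auto
    also have "(\<Sum>i\<in>{i. i < n \<and> u i = v}. ennreal (1 / real (N v))) = ennreal (real (N v) * (1 / real (N v)))"
      by (subst ennreal_mult) (auto simp: N_def[symmetric] ennreal_of_nat_eq_real_of_nat)
    also have "\<dots> = 1"
      using that N_pos by (auto simp: divide_simps)
    finally show ?thesis .
  qed
  have \<theta>_sum: "(\<Sum>i<n. \<theta> v i) = 1" if "v \<in> u ` {..<n}" for v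
  proof -
    have "(\<Sum>i<n. \<theta> v i) = (\<Sum>i<n. if v = u i then ennreal (1 / real (N v)) else 0)"
      by (intro sum.cong) (auto simp: \<theta>_def)
    then show ?thesis using count[OF that] by simp
  qed
  \<comment> \<open>The joint law of an index and a pair. Its index is uniform on
    \<open>{..<n}\<close> (\<open>int_index\<close>), its pair has law \<open>\<pi>\<close>
    (\<open>int_snd\<close>), and it is concentrated where the first entry of the pair is
    \<open>u i\<close>.\<close>
  define \<mu> where "\<mu> = density (count_space {..<n} \<Otimes>\<^sub>M \<pi>) (\<lambda>(i, q). \<theta> (fst q) i)"
  have [measurable]: "(\<lambda>(i, q). \<theta> (fst q) i) \<in> borel_measurable (count_space {..<n} \<Otimes>\<^sub>M \<pi>)"
    by (rule measurable_pair_measure_countable1) auto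
  have sets_\<mu>[measurable_cong]: "sets \<mu> = sets (count_space {..<n} \<Otimes>\<^sub>M \<pi>)"
    by (simp add: \<mu>_def)
  have nn_\<mu>: "(\<integral>\<^sup>+ z. H (fst z) (snd z) \<partial>\<mu>) = (\<Sum>i<n. \<integral>\<^sup>+ q. \<theta> (fst q) i * H i q \<partial>\<pi>)"
    if "\<And>i. i < n \<Longrightarrow> H i \<in> borel_measurable (borel \<Otimes>\<^sub>M borel)" for H :: "nat \<Rightarrow> 'y \<times> 'y \<Rightarrow> ennreal"
  proof -
    have [measurable]: "(\<lambda>z. H (fst z) (snd z)) \<in> borel_measurable (count_space {..<n} \<Otimes>\<^sub>M \<pi>)"
      using that by (intro measurable_pair_measure_countable1) auto
    have "(\<integral>\<^sup>+ z. H (fst z) (snd z) \<partial>\<mu>)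
        = (\<integral>\<^sup>+ z. (case z of (i, q) \<Rightarrow> \<theta> (fst q) i) * H (fst z) (snd z) \<partial>(count_space {..<n} \<Otimes>\<^sub>M \<pi>))"
      unfolding \<mu>_def by (subst nn_integral_density) auto
    also have "\<dots> = (\<integral>\<^sup>+ i. \<integral>\<^sup>+ q. \<theta> (fst q) i * H i q \<partial>\<pi> \<partial>count_space {..<n})"
      by (subst nn_integral_fst[symmetric]) auto
    also have "\<dots> = (\<Sum>i<n. \<integral>\<^sup>+ q. \<theta> (fst q) i * H i q \<partial>\<pi>)"
      by (simp add: nn_integral_count_space_finite)
    finally show ?thesis .
  qed
  \<comment> \<open>Away from the atoms all weights are 0, so they sum to 1 only almost
    everywhere.\<close>
  have AE_fst: "AE q in \<pi>. fst q \<in> u ` {..<n}"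
  proof -
    have "AE v in distr \<pi> borel fst. v \<in> u ` {..<n}"
      unfolding \<pi>1 by (rule AE_empirical) (auto intro!: predE pred_sets2 simp: pred_def finite_imp_closed)
    then show ?thesis
      by (subst (asm) AE_distr_iff) (auto simp: finite_imp_closed)
  qed
  have int_snd: "(\<Sum>i<n. \<integral>\<^sup>+ q. \<theta> (fst q) i * K q \<partial>\<pi>) = (\<integral>\<^sup>+ q. K q \<partial>\<pi>)"
    if [measurable]: "K \<in> borel_measurable (borel \<Otimes>\<^sub>M borel)" for K
  proof -
    have "(\<Sum>i<n. \<integral>\<^sup>+ q. \<theta> (fst q) i * K q \<partial>\<pi>) = (\<integral>\<^sup>+ q. (\<Sum>i<n. \<theta> (fst q) i * K q) \<partial>\<pi>)"
      by (subst nn_integral_sum) auto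
    also have "\<dots> = (\<integral>\<^sup>+ q. K q \<partial>\<pi>)"
      using AE_fst by (intro nn_integral_cong_AE) (auto simp: sum_distrib_right[symmetric] \<theta>_sum)
    finally show ?thesis .
  qed
  have int_\<theta>: "(\<integral>\<^sup>+ q. \<theta> (fst q) i \<partial>\<pi>) = ennreal (1 / real n)" if "i < n" for i
  proof -
    have "(\<integral>\<^sup>+ q. \<theta> (fst q) i \<partial>\<pi>) = (\<integral>\<^sup>+ v. \<theta> v i \<partial>empirical n u)"
      unfolding \<pi>1[symmetric] by (subst nn_integral_distr) auto
    also have "\<dots> = ennreal (1 / real n) * (\<Sum>j<n. \<theta> (u j) i)"
      by (subst nn_integral_empirical) (auto simp: sum_distrib_left)
    also have "(\<Sum>j<n. \<theta> (u j) i) = (\<Sum>j<n. if u i = u j then ennreal (1 / real (N (u i))) else 0)"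
      by (intro sum.cong) (auto simp: \<theta>_def)
    also have "\<dots> = 1" using that by (intro count) auto
    finally show ?thesis by simp
  qed
  have int_index: "(\<Sum>i<n. \<integral>\<^sup>+ q. \<theta> (fst q) i * h i \<partial>\<pi>) = (\<Sum>i<n. ennreal (1 / real n) * h i)" for h
    by (intro sum.cong) (auto simp: nn_integral_multc int_\<theta>)
  \<comment> \<open>The atom is replaced by \<open>w i\<close> and the partner drawn from
    \<open>Q\<close> is kept.\<close>
  define T where "T = (\<lambda>z :: nat \<times> 'y \<times> 'y. (w (fst z), snd (snd z)))"
  have T[measurable]: "T \<in> \<mu> \<rightarrow>\<^sub>M (borel \<Otimes>\<^sub>M borel)"
    unfolding T_def measurable_cong_sets[OF sets_\<mu> refl]
    by (intro measurable_pair_measure_countable1) auto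
  have "distr (distr \<mu> (borel \<Otimes>\<^sub>M borel) T) borel fst = empirical n w"
  proof (rule measure_eqI)
    fix A assume "A \<in> sets (distr (distr \<mu> (borel \<Otimes>\<^sub>M borel) T) borel fst)"
    then have [measurable]: "A \<in> sets borel" by simp
    have "emeasure (distr (distr \<mu> (borel \<Otimes>\<^sub>M borel) T) borel fst) A
        = (\<integral>\<^sup>+ z. indicator A (w (fst z)) \<partial>\<mu>)"
      by (simp add: nn_integral_indicator[symmetric] nn_integral_distr T_def[symmetric] del: nn_integral_indicator)
         (simp add: T_def)
    also have "\<dots> = (\<Sum>i<n. \<integral>\<^sup>+ q. \<theta> (fst q) i * indicator A (w i) \<partial>\<pi>)"
      by (rule nn_\<mu>) auto
    also have "\<dots> = (\<integral>\<^sup>+ y. indicator A y \<partial>empirical n w)"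
      by (simp add: int_index nn_integral_empirical del: nn_integral_indicator)
    finally show "emeasure (distr (distr \<mu> (borel \<Otimes>\<^sub>M borel) T) borel fst) A = emeasure (empirical n w) A"
      by simp
  qed simp
  moreover have "distr (distr \<mu> (borel \<Otimes>\<^sub>M borel) T) borel snd = Q"
  proof (rule measure_eqI)
    fix A assume "A \<in> sets (distr (distr \<mu> (borel \<Otimes>\<^sub>M borel) T) borel snd)"
    then have [measurable]: "A \<in> sets borel" by simp
    have "emeasure (distr (distr \<mu> (borel \<Otimes>\<^sub>M borel) T) borel snd) A
        = (\<integral>\<^sup>+ z. indicator A (snd (snd z)) \<partial>\<mu>)"
      by (simp add: nn_integral_indicator[symmetric] nn_integral_distr T_def[symmetric] del: nn_integral_indicator)
         (simp add: T_def)
    also have "\<dots> = (\<Sum>i<n. \<integral>\<^sup>+ q. \<theta> (fst q) i * indicator A (snd q) \<partial>\<pi>)"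
      by (rule nn_\<mu>) auto
    also have "\<dots> = (\<integral>\<^sup>+ q. indicator A (snd q) \<partial>\<pi>)"
      by (rule int_snd) auto
    also have "\<dots> = (\<integral>\<^sup>+ y. indicator A y \<partial>Q)"
      unfolding \<pi>2[symmetric] by (subst nn_integral_distr) auto
    finally show "emeasure (distr (distr \<mu> (borel \<Otimes>\<^sub>M borel) T) borel snd) A = emeasure Q A"
      by (simp add: \<pi>2[symmetric])
  qed (simp add: \<pi>2[symmetric])
  ultimately have "distr \<mu> (borel \<Otimes>\<^sub>M borel) T \<in> couplings (empirical n w) Q"
    by (simp add: couplings_def)
  moreover have "(\<integral>\<^sup>+ q. ennreal (norm (fst q - snd q) powr p) \<partial>distr \<mu> (borel \<Otimes>\<^sub>M borel) T)
      \<le> ennreal ((s + r) powr p)"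
  proof -
    have m1[measurable]: "(\<lambda>z. norm (w (fst z) - u (fst z))) \<in> borel_measurable \<mu>"
      unfolding measurable_cong_sets[OF sets_\<mu> refl] by (intro measurable_pair_measure_countable1) auto
    have m2[measurable]: "(\<lambda>z. norm (u (fst z) - snd (snd z))) \<in> borel_measurable \<mu>"
      unfolding measurable_cong_sets[OF sets_\<mu> refl] by (intro measurable_pair_measure_countable1) auto
    have "(\<integral>\<^sup>+ z. ennreal (norm (w (fst z) - u (fst z)) powr p) \<partial>\<mu>)
        = (\<Sum>i<n. \<integral>\<^sup>+ q. \<theta> (fst q) i * ennreal (norm (w i - u i) powr p) \<partial>\<pi>)"
      by (rule nn_\<mu>) auto
    also have "\<dots> = (\<Sum>i<n. ennreal (1 / real n) * ennreal (norm (w i - u i) powr p))"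
      by (rule int_index)
    also have "\<dots> = ennreal (1 / real n * (\<Sum>i<n. norm (w i - u i) powr p))"
      by (simp add: ennreal_mult[symmetric] sum_distrib_left)
    finally have b1: "(\<integral>\<^sup>+ z. ennreal (norm (w (fst z) - u (fst z)) powr p) \<partial>\<mu>) \<le> ennreal (s powr p)"
      using shift by (simp add: ennreal_leI)
    have "(\<integral>\<^sup>+ z. ennreal (norm (u (fst z) - snd (snd z)) powr p) \<partial>\<mu>)
        = (\<Sum>i<n. \<integral>\<^sup>+ q. \<theta> (fst q) i * ennreal (norm (u i - snd q) powr p) \<partial>\<pi>)"
      by (rule nn_\<mu>) auto
    \<comment> \<open>The weight vanishes unless \<open>fst q = u i\<close>.\<close>
    also have "\<dots> = (\<Sum>i<n. \<integral>\<^sup>+ q. \<theta> (fst q) i * ennreal (norm (fst q - snd q) powr p) \<partial>\<pi>)"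
      by (intro sum.cong nn_integral_cong) (auto simp: \<theta>_def)
    also have "\<dots> = (\<integral>\<^sup>+ q. ennreal (norm (fst q - snd q) powr p) \<partial>\<pi>)"
      by (rule int_snd) auto
    finally have b2: "(\<integral>\<^sup>+ z. ennreal (norm (u (fst z) - snd (snd z)) powr p) \<partial>\<mu>) \<le> ennreal (r powr p)"
      using cost by simp
    have "(\<integral>\<^sup>+ q. ennreal (norm (fst q - snd q) powr p) \<partial>distr \<mu> (borel \<Otimes>\<^sub>M borel) T)
        = (\<integral>\<^sup>+ z. ennreal (norm (w (fst z) - snd (snd z)) powr p) \<partial>\<mu>)"
      by (subst nn_integral_distr) (auto simp: T_def)
    also have "\<dots> \<le> (\<integral>\<^sup>+ z. ennreal ((norm (w (fst z) - u (fst z)) + norm (u (fst z) - snd (snd z))) powr p) \<partial>\<mu>)"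
      using p by (intro nn_integral_mono ennreal_leI powr_mono2) (auto intro: norm_diff_triangle_le)
    also have "\<dots> \<le> ennreal ((s + r) powr p)"
      by (rule nn_integral_powr_add_le[OF p s r m1 m2 _ _ b1 b2]) auto
    finally show ?thesis .
  qed
  ultimately show ?thesis by (rule that)
qed

subsection \<open>Expectations of locally Lipschitz costs under a coupling\<close>

text \<open>Measured in units of \<open>r\<close>, the distance \<open>t\<close> of the coupled
  points has \<open>p\<close>-th moment at most 1. Each power of \<open>t\<close> in the growth
  bound is at most \<open>1 + t powr p\<close>, the square occurring only when \<open>L = 0\<close>
  or \<open>p \<ge> 2\<close>, and one factor \<open>r\<close> remains outside. The first and third
  conclusions allow the lemma to be applied again with \<open>Q1\<close> in the role of
  \<open>Q2\<close>.\<close>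

lemma coupling_expectation_diff:
  fixes c :: "'y::euclidean_space \<Rightarrow> real"
  assumes \<pi>: "\<pi> \<in> couplings Q1 Q2" and "prob_space Q2" and [measurable]: "c \<in> borel_measurable borel"
    and S1: "AE y in Q1. y \<in> S" and S2: "AE y in Q2. y \<in> S" and [measurable]: "S \<in> sets borel"
    and growth: "\<And>y1 y2. y1 \<in> S \<Longrightarrow> y2 \<in> S \<Longrightarrow>
      \<bar>c y1 - c y2\<bar> \<le> (K + L * norm y2 + L * norm (y1 - y2)) * norm (y1 - y2)"
    and KL: "0 \<le> K" "0 \<le> L" "L = 0 \<or> 2 \<le> p" and p: "1 \<le> p" and r: "0 < r"
    and cost: "(\<integral>\<^sup>+ q. ennreal (norm (fst q - snd q) powr p) \<partial>\<pi>) \<le> ennreal (r powr p)"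
    and m: "0 \<le> m" "(\<integral>\<^sup>+ y. ennreal (L * (norm y)\<^sup>2) \<partial>Q2) \<le> ennreal m"
    and int: "integrable Q2 c"
  shows "integrable Q1 c"
    and "\<bar>(\<integral>y. c y \<partial>Q1) - (\<integral>y. c y \<partial>Q2)\<bar> \<le> r * (2 * (K + L * (1/2 + r)) + m / 2)"
    and "(\<integral>\<^sup>+ y. ennreal (L * (norm y)\<^sup>2) \<partial>Q1) \<le> ennreal (2 * m + 4 * (L * r\<^sup>2))"
proof -
  note [measurable_cong] = couplingsD(2)[OF \<pi>]
  interpret prob_space \<pi> using \<pi> \<open>prob_space Q2\<close> by (rule coupling_prob_space)
  have Q1: "Q1 = distr \<pi> borel fst" and Q2: "Q2 = distr \<pi> borel snd"
    using couplingsD[OF \<pi>] by auto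
  define t where "t q = norm (fst q - snd q) / r" for q :: "'y \<times> 'y"
  have [measurable]: "t \<in> borel_measurable (borel \<Otimes>\<^sub>M borel)"
    unfolding t_def by measurable
  have t0: "0 \<le> t q" for q using r by (simp add: t_def)
  have norm_t: "norm (fst q - snd q) = r * t q" for q using r by (simp add: t_def)
  have powr_bounds: "x \<le> 1 + x powr p" "L * x\<^sup>2 \<le> L * (1 + x powr p)" if "0 \<le> x" for x :: real
  proof -
    show "x \<le> 1 + x powr p"
    proof (cases "x \<le> 1")
      case False
      then show ?thesis using powr_mono[of 1 p x] p by simp
    qed (use powr_ge_zero[of x p] in linarith)
    show "L * x\<^sup>2 \<le> L * (1 + x powr p)"
      using KL square_le_one_plus_powr[OF _ that] by (auto intro: mult_left_mono)
  qed
  have t_int: "(\<integral>\<^sup>+ q. ennreal (1 + t q powr p) \<partial>\<pi>) \<le> 2"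
  proof -
    have "(\<integral>\<^sup>+ q. ennreal (t q powr p) \<partial>\<pi>)
        = (\<integral>\<^sup>+ q. ennreal (1 / r powr p) * ennreal (norm (fst q - snd q) powr p) \<partial>\<pi>)"
      using r by (intro nn_integral_cong) (simp add: t_def powr_divide ennreal_mult[symmetric])
    also have "\<dots> = ennreal (1 / r powr p) * (\<integral>\<^sup>+ q. ennreal (norm (fst q - snd q) powr p) \<partial>\<pi>)"
      by (rule nn_integral_cmult) auto
    also have "\<dots> \<le> ennreal (1 / r powr p) * ennreal (r powr p)"
      by (intro mult_left_mono cost) auto
    also have "\<dots> = 1" using r by (simp add: ennreal_mult[symmetric])
    finally have "(\<integral>\<^sup>+ q. ennreal (t q powr p) \<partial>\<pi>) \<le> 1" .
    then have "1 + (\<integral>\<^sup>+ q. ennreal (t q powr p) \<partial>\<pi>) \<le> 1 + 1"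
      by (rule add_left_mono)
    then show ?thesis
      by (simp add: nn_integral_add emeasure_space_1)
  qed
  have AE_S: "AE q in \<pi>. fst q \<in> S" "AE q in \<pi>. snd q \<in> S"
    using S1 S2 unfolding Q1 Q2 by (simp_all add: AE_distr_iff)
  have m': "(\<integral>\<^sup>+ q. ennreal (L * (norm (snd q))\<^sup>2) \<partial>\<pi>) \<le> ennreal m"
    using m(2) unfolding Q2 by (simp add: nn_integral_distr)
  \<comment> \<open>The part of the growth bound multiplying \<open>1 + t powr p\<close>:
    \<open>K\<close> from the linear term, \<open>L / 2\<close> from splitting the mixed term
    \<open>L * norm (snd q) * t\<close> by Young's inequality, and \<open>L * r\<close> from the
    quadratic term.\<close>
  define b where "b = K + L * (1/2 + r)"
  have b: "0 \<le> b" using KL r by (simp add: b_def)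
  define h where "h q = r * (b * (1 + t q powr p) + L * (norm (snd q))\<^sup>2 / 2)" for q
  have [measurable]: "h \<in> borel_measurable (borel \<Otimes>\<^sub>M borel)"
    unfolding h_def by measurable
  have diff_le: "\<bar>c (fst q) - c (snd q)\<bar> \<le> h q" if "fst q \<in> S" "snd q \<in> S" for q
  proof -
    have "L * (norm (snd q) * t q) \<le> L * ((norm (snd q))\<^sup>2 / 2 + (t q)\<^sup>2 / 2)"
      using sum_squares_bound[of "norm (snd q)" "t q"] KL by (intro mult_left_mono) auto
    then have "(K + L * norm (snd q) + L * (r * t q)) * t q
        \<le> K * t q + (L * (norm (snd q))\<^sup>2 / 2 + L * (t q)\<^sup>2 / 2) + r * (L * (t q)\<^sup>2)"
      by (simp add: algebra_simps power2_eq_square)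
    also have "\<dots> = K * t q + (1/2 + r) * (L * (t q)\<^sup>2) + L * (norm (snd q))\<^sup>2 / 2"
      by (simp add: algebra_simps)
    also have "\<dots> \<le> K * (1 + t q powr p) + (1/2 + r) * (L * (1 + t q powr p)) + L * (norm (snd q))\<^sup>2 / 2"
      using KL(1) r mult_left_mono[OF powr_bounds(1)[OF t0[of q]], of K]
        mult_left_mono[OF powr_bounds(2)[OF t0[of q]], of "1/2 + r"] by linarith
    also have "\<dots> = b * (1 + t q powr p) + L * (norm (snd q))\<^sup>2 / 2"
      by (simp add: b_def algebra_simps)
    finally have "r * ((K + L * norm (snd q) + L * (r * t q)) * t q) \<le> h q"
      unfolding h_def using r by (intro mult_left_mono) auto
    moreover have "\<bar>c (fst q) - c (snd q)\<bar> \<le> r * ((K + L * norm (snd q) + L * (r * t q)) * t q)"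
      using growth[OF that] unfolding norm_t by (simp add: mult.left_commute mult.commute)
    ultimately show ?thesis by simp
  qed
  have bound: "(\<integral>\<^sup>+ q. ennreal \<bar>c (fst q) - c (snd q)\<bar> \<partial>\<pi>) \<le> ennreal (r * (2 * b + m / 2))"
  proof -
    have "(\<integral>\<^sup>+ q. ennreal \<bar>c (fst q) - c (snd q)\<bar> \<partial>\<pi>) \<le> (\<integral>\<^sup>+ q. ennreal (h q) \<partial>\<pi>)"
      using AE_S by (intro nn_integral_mono_AE) (auto intro: diff_le ennreal_leI)
    also have "\<dots> = (\<integral>\<^sup>+ q. ennreal (r * b) * ennreal (1 + t q powr p)
        + ennreal (r / 2) * ennreal (L * (norm (snd q))\<^sup>2) \<partial>\<pi>)"
      using r b KL
      by (intro nn_integral_cong)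
         (simp add: h_def ennreal_mult[symmetric] ennreal_plus[symmetric] algebra_simps del: ennreal_plus)
    also have "\<dots> = ennreal (r * b) * (\<integral>\<^sup>+ q. ennreal (1 + t q powr p) \<partial>\<pi>)
        + ennreal (r / 2) * (\<integral>\<^sup>+ q. ennreal (L * (norm (snd q))\<^sup>2) \<partial>\<pi>)"
      by (subst nn_integral_add) (auto simp: nn_integral_cmult)
    also have "\<dots> \<le> ennreal (r * b) * 2 + ennreal (r / 2) * ennreal m"
      by (intro add_mono mult_left_mono t_int m') auto
    also have "\<dots> = ennreal (r * b * 2) + ennreal (r / 2 * m)"
      using r b m by (simp add: ennreal_mult[symmetric] flip: ennreal_numeral)
    also have "\<dots> = ennreal (r * (2 * b + m / 2))"
      using r b m by (simp add: ennreal_plus[symmetric] algebra_simps del: ennreal_plus)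
    finally show ?thesis .
  qed
  have int_snd: "integrable \<pi> (\<lambda>q. c (snd q))"
    using int unfolding Q2 by (simp add: integrable_distr_eq)
  have int_diff: "integrable \<pi> (\<lambda>q. c (fst q) - c (snd q))"
    using bound by (intro integrableI_bounded) (auto intro: le_less_trans)
  have int_fst: "integrable \<pi> (\<lambda>q. c (fst q))"
    using Bochner_Integration.integrable_add[OF int_diff int_snd] by simp
  then show "integrable Q1 c"
    unfolding Q1 by (simp add: integrable_distr_eq)
  have "(\<integral>y. c y \<partial>Q1) - (\<integral>y. c y \<partial>Q2) = (\<integral>q. c (fst q) - c (snd q) \<partial>\<pi>)"
    unfolding Q1 Q2 using int_fst int_snd by (simp add: integral_distr)
  moreover have "\<bar>\<integral>q. c (fst q) - c (snd q) \<partial>\<pi>\<bar> \<le> (\<integral>q. \<bar>c (fst q) - c (snd q)\<bar> \<partial>\<pi>)"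
    by (rule integral_abs_bound)
  moreover have "(\<integral>q. \<bar>c (fst q) - c (snd q)\<bar> \<partial>\<pi>) \<le> r * (2 * b + m / 2)"
  proof -
    have "ennreal (\<integral>q. \<bar>c (fst q) - c (snd q)\<bar> \<partial>\<pi>) = (\<integral>\<^sup>+ q. ennreal \<bar>c (fst q) - c (snd q)\<bar> \<partial>\<pi>)"
      using int_diff by (intro nn_integral_eq_integral[symmetric]) auto
    then have "ennreal (\<integral>q. \<bar>c (fst q) - c (snd q)\<bar> \<partial>\<pi>) \<le> ennreal (r * (2 * b + m / 2))"
      using bound by (rule ord_eq_le_trans)
    then show ?thesis
      using r b m(1) by (subst (asm) ennreal_le_iff) auto
  qed
  ultimately show "\<bar>(\<integral>y. c y \<partial>Q1) - (\<integral>y. c y \<partial>Q2)\<bar> \<le> r * (2 * (K + L * (1/2 + r)) + m / 2)"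
    unfolding b_def by linarith
  \<comment> \<open>The square of a sum is at most twice the sum of the squares; as
    \<open>1 + t powr p\<close> integrates to at most 2, the \<open>r\<close>-term ends with the
    factor 4.\<close>
  have "L * (norm (fst q))\<^sup>2 \<le> 2 * (L * (norm (snd q))\<^sup>2) + 2 * (L * r\<^sup>2) * (1 + t q powr p)" for q
  proof -
    have "norm (fst q) \<le> norm (snd q) + r * t q"
      unfolding norm_t[symmetric] by (metis add.commute norm_triangle_sub)
    then have "(norm (fst q))\<^sup>2 \<le> (norm (snd q) + r * t q)\<^sup>2"
      by (intro power_mono) auto
    also have "\<dots> \<le> 2 * (norm (snd q))\<^sup>2 + 2 * (r * t q)\<^sup>2"
      using sum_squares_bound[of "norm (snd q)" "r * t q"] by (simp add: power2_sum)
    finally have "L * (norm (fst q))\<^sup>2 \<le> L * (2 * (norm (snd q))\<^sup>2 + 2 * (r * t q)\<^sup>2)"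
      using KL by (intro mult_left_mono) auto
    also have "\<dots> = 2 * (L * (norm (snd q))\<^sup>2) + 2 * r\<^sup>2 * (L * (t q)\<^sup>2)"
      by (simp add: algebra_simps power_mult_distrib)
    also have "\<dots> \<le> 2 * (L * (norm (snd q))\<^sup>2) + 2 * r\<^sup>2 * (L * (1 + t q powr p))"
      using mult_left_mono[OF powr_bounds(2)[OF t0[of q]], of "2 * r\<^sup>2"] by simp
    finally show ?thesis by (simp add: algebra_simps)
  qed
  then have "(\<integral>\<^sup>+ q. ennreal (L * (norm (fst q))\<^sup>2) \<partial>\<pi>)
      \<le> (\<integral>\<^sup>+ q. 2 * ennreal (L * (norm (snd q))\<^sup>2) + ennreal (2 * (L * r\<^sup>2)) * ennreal (1 + t q powr p) \<partial>\<pi>)"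
    using KL
    by (intro nn_integral_mono)
       (simp add: ennreal_mult[symmetric] ennreal_plus[symmetric] ennreal_leI
          flip: ennreal_numeral del: ennreal_plus)
  also have "\<dots> = 2 * (\<integral>\<^sup>+ q. ennreal (L * (norm (snd q))\<^sup>2) \<partial>\<pi>)
      + ennreal (2 * (L * r\<^sup>2)) * (\<integral>\<^sup>+ q. ennreal (1 + t q powr p) \<partial>\<pi>)"
    by (subst nn_integral_add) (auto simp: nn_integral_cmult)
  also have "\<dots> \<le> 2 * ennreal m + ennreal (2 * (L * r\<^sup>2)) * 2"
    by (intro add_mono mult_left_mono t_int m') auto
  also have "\<dots> = ennreal (2 * m) + ennreal (2 * (L * r\<^sup>2) * 2)"
    using m KL by (simp add: ennreal_mult[symmetric] flip: ennreal_numeral)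
  also have "\<dots> = ennreal (2 * m + 4 * (L * r\<^sup>2))"
    using m KL by (simp add: ennreal_plus[symmetric] del: ennreal_plus)
  finally show "(\<integral>\<^sup>+ y. ennreal (L * (norm y)\<^sup>2) \<partial>Q1) \<le> ennreal (2 * m + 4 * (L * r\<^sup>2))"
    unfolding Q1 by (simp add: nn_integral_distr)
qed

text \<open>Mean value inequality on the segment from \<open>y2\<close> to \<open>y1\<close>. The
  gradient there is compared with the one at \<open>y2\<close>, and that one with the gradient at a
  fixed \<open>y0\<close>, so that \<open>K\<close> depends on neither endpoint.\<close>

lemma gradient_growth:
  fixes c :: "'y::euclidean_space \<Rightarrow> real"
  assumes "convex S"
    and deriv: "\<And>y. y \<in> S \<Longrightarrow> (c has_derivative (\<lambda>h. grad y \<bullet> h)) (at y within S)"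
    and lip: "\<And>y y'. y \<in> S \<Longrightarrow> y' \<in> S \<Longrightarrow> norm (grad y' - grad y) \<le> L * norm (y' - y)"
  shows "\<exists>K L. 0 \<le> K \<and> 0 \<le> L \<and> (\<forall>y1\<in>S. \<forall>y2\<in>S.
    \<bar>c y1 - c y2\<bar> \<le> (K + L * norm y2 + L * norm (y1 - y2)) * norm (y1 - y2))"
proof (cases "S = {}")
  case True
  then show ?thesis by auto
next
  case False
  then obtain y0 where y0: "y0 \<in> S" by auto
  \<comment> \<open>The constant \<open>L\<close> may be negative, for instance when
    \<open>S\<close> is a single point.\<close>
  define B where "B = \<bar>L\<bar>"
  define K where "K = norm (grad y0) + B * norm y0"
  have lip': "norm (grad y' - grad y) \<le> B * norm (y' - y)" if "y \<in> S" "y' \<in> S" for y y'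
    using lip[OF that] mult_right_mono[OF abs_ge_self[of L], of "norm (y' - y)"] by (simp add: B_def)
  have "\<bar>c y1 - c y2\<bar> \<le> (K + B * norm y2 + B * norm (y1 - y2)) * norm (y1 - y2)"
    if y: "y1 \<in> S" "y2 \<in> S" for y1 y2
  proof -
    have seg: "closed_segment y2 y1 \<subseteq> S"
      using y \<open>convex S\<close> by (simp add: closed_segment_subset)
    have "norm (c y1 - c y2) \<le> (K + B * norm y2 + B * norm (y1 - y2)) * norm (y1 - y2)"
    proof (rule differentiable_bound)
      fix x assume x: "x \<in> closed_segment y2 y1"
      then have "x \<in> S" using seg by auto
      show "(c has_derivative (\<lambda>h. grad x \<bullet> h)) (at x within closed_segment y2 y1)"
        using deriv[OF \<open>x \<in> S\<close>] seg by (rule has_derivative_subset)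
      have "norm (grad x) \<le> norm (grad y0) + B * norm (y2 - y0) + B * norm (x - y2)"
        using norm_triangle_sub[of "grad x" "grad y2"] norm_triangle_sub[of "grad y2" "grad y0"]
          lip'[OF y(2) \<open>x \<in> S\<close>] lip'[OF y0 y(2)] by linarith
      also have "B * norm (y2 - y0) \<le> B * (norm y2 + norm y0)"
        by (intro mult_left_mono norm_triangle_ineq4) (simp add: B_def)
      also have "B * norm (x - y2) \<le> B * norm (y1 - y2)"
        using segment_bound(1)[OF x] by (intro mult_left_mono) (simp_all add: B_def)
      finally have "norm (grad x) \<le> K + B * norm y2 + B * norm (y1 - y2)"
        by (simp add: K_def algebra_simps)
      moreover have "onorm ((\<bullet>) (grad x)) \<le> norm (grad x)"
        by (rule onorm_bound) (auto simp: Cauchy_Schwarz_ineq2)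
      ultimately show "onorm ((\<bullet>) (grad x)) \<le> K + B * norm y2 + B * norm (y1 - y2)"
        by simp
    qed auto
    then show ?thesis by simp
  qed
  moreover have "0 \<le> K" "0 \<le> B" by (auto simp: K_def B_def)
  ultimately show ?thesis by blast
qed

text \<open>The points \<open>u i\<close> lie in \<open>S\<close>, so projecting leaves them fixed;
  as the projection is nonexpansive, \<open>w i\<close> differs from \<open>u i\<close> by at most
  the error of \<open>h\<close> at \<open>x\<close> plus its error at \<open>\<xi> i\<close>. In
  \<open>p\<close>-th mean this is at most \<open>2 * k\<close>, and the coupling of the
  \<open>u i\<close> with \<open>P\<close> can be shifted to the \<open>w i\<close>.\<close>

lemma residual_coupling:
  fixes f h :: "'x \<Rightarrow> 'y::euclidean_space" and y :: "nat \<Rightarrow> 'y"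
  assumes n: "n \<ge> 1" and p: "1 \<le> p" and S: "convex S" "closed S"
    and in_S: "\<And>i. i < n \<Longrightarrow> f x + (y i - f (\<xi> i)) \<in> S"
    and k: "0 < k" "norm (f x - h x) \<le> k"
      "1 / real n * (\<Sum>i<n. norm (f (\<xi> i) - h (\<xi> i)) powr p) \<le> k powr p"
    and r: "0 < r" "wasserstein p (empirical n (\<lambda>i. f x + (y i - f (\<xi> i)))) P < ennreal r"
  obtains \<pi> where "\<pi> \<in> couplings (empirical n (\<lambda>i. closest_point S (h x + (y i - h (\<xi> i))))) P"
    "(\<integral>\<^sup>+ q. ennreal (norm (fst q - snd q) powr p) \<partial>\<pi>) \<le> ennreal ((2 * k + r) powr p)"
proof -
  define u where "u i = f x + (y i - f (\<xi> i))" for i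
  define w where "w i = closest_point S (h x + (y i - h (\<xi> i)))" for i
  define b where "b i = norm (f (\<xi> i) - h (\<xi> i))" for i
  obtain \<pi> where \<pi>: "\<pi> \<in> couplings (empirical n u) P"
    "(\<integral>\<^sup>+ q. ennreal (norm (fst q - snd q) powr p) \<partial>\<pi>) \<le> ennreal (r powr p)"
    using wasserstein_less_imp_coupling[of p r "empirical n u" P] r p unfolding u_def by auto
  have average: "1 / real n * (\<Sum>i<n. A + B * g i) = A + B * (1 / real n * (\<Sum>i<n. g i))"
    for A B :: real and g
    using n by (simp add: sum.distrib sum_distrib_left[symmetric] add_divide_distrib)
  have dist_le: "norm (w i - u i) \<le> k + b i" if "i < n" for i
  proof -
    have "S \<noteq> {}" using in_S that by blast
    have "norm (w i - u i) = dist (w i) (closest_point S (u i))"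
      using in_S[OF that] by (simp add: u_def closest_point_self dist_norm)
    also have "\<dots> \<le> dist (h x + (y i - h (\<xi> i))) (u i)"
      unfolding w_def by (rule closest_point_lipschitz[OF S \<open>S \<noteq> {}\<close>])
    also have "\<dots> = norm ((h x - f x) + (f (\<xi> i) - h (\<xi> i)))"
      unfolding u_def dist_norm by (rule arg_cong[where f = norm]) (simp add: algebra_simps)
    also have "\<dots> \<le> norm (h x - f x) + b i"
      unfolding b_def by (rule norm_triangle_ineq)
    also have "\<dots> \<le> k + b i"
      using k(2) by (simp add: norm_minus_commute[of "h x"])
    finally show ?thesis .
  qed
  have "norm (w i - u i) powr p \<le> (2 * k) powr p / 2 + (2 * k) powr p / 2 / k powr p * b i powr p"
    if "i < n" for i
  proof -
    have "norm (w i - u i) powr p \<le> (k + b i) powr p"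
      using dist_le[OF that] p by (intro powr_mono2) auto
    \<comment> \<open>The weighted inequality with both weights equal to \<open>k\<close>.\<close>
    also have "\<dots> \<le> (2 * k) powr p / 2 + (2 * k) powr p / 2 / k powr p * b i powr p"
    proof -
      have "k + k = 2 * k" "k / (2 * k) = 1 / 2" "k powr p > 0" "0 \<le> b i"
        using k(1) by (auto simp: b_def)
      then show ?thesis
        using powr_add_le_weighted[OF p less_imp_le[OF k(1)] \<open>0 \<le> b i\<close> k(1) k(1)] by simp
    qed
    finally show ?thesis .
  qed
  then have "(\<Sum>i<n. norm (w i - u i) powr p)
      \<le> (\<Sum>i<n. (2 * k) powr p / 2 + (2 * k) powr p / 2 / k powr p * b i powr p)"
    by (intro sum_mono) auto
  then have "1 / real n * (\<Sum>i<n. norm (w i - u i) powr p)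
      \<le> 1 / real n * (\<Sum>i<n. (2 * k) powr p / 2 + (2 * k) powr p / 2 / k powr p * b i powr p)"
    by (intro mult_left_mono) auto
  also have "\<dots> = (2 * k) powr p / 2 + (2 * k) powr p / 2 / k powr p * (1 / real n * (\<Sum>i<n. b i powr p))"
    by (rule average)
  also have "\<dots> \<le> (2 * k) powr p / 2 + (2 * k) powr p / 2 / k powr p * k powr p"
    using k(3) unfolding b_def by (intro add_left_mono mult_left_mono) auto
  also have "\<dots> = (2 * k) powr p"
    using k(1) by simp
  finally have shift: "1 / real n * (\<Sum>i<n. norm (w i - u i) powr p) \<le> (2 * k) powr p" .
  show ?thesis
    using coupling_shift_empirical[OF n p r(1) _ \<pi> shift] k(1) that unfolding w_def by auto
qed

section \<open>Comparing members of the ambiguity set with the true law\<close>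

lemma borel_measurable_indicator_continuous_on:
  fixes c :: "'y::euclidean_space \<Rightarrow> real"
  assumes "closed S" "continuous_on S c"
  shows "(\<lambda>y. indicator S y *\<^sub>R c y) \<in> borel_measurable borel"
  using assms by (intro borel_measurable_continuous_on_indicator) auto

text \<open>Two comparisons, from \<open>P\<close> to the empirical measure and from there to
  \<open>Q\<close>. The first also supplies the integrability and the second-moment bound that the
  second one starts from.\<close>

lemma ambiguity_set_expectation_diff:
  fixes c :: "'y::euclidean_space \<Rightarrow> real"
  assumes n: "n \<ge> 1" and p: "1 \<le> p" and S: "closed S" and w: "\<And>i. i < n \<Longrightarrow> w i \<in> S"
    and P: "prob_space P" "AE y in P. y \<in> S"
    and \<pi>: "\<pi> \<in> couplings (empirical n w) P"
    and \<zeta>: "0 < \<zeta>" and cost: "(\<integral>\<^sup>+ q. ennreal (norm (fst q - snd q) powr p) \<partial>\<pi>) \<le> ennreal (\<zeta> powr p)"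
    and cont: "continuous_on S c"
    and growth: "\<And>y1 y2. y1 \<in> S \<Longrightarrow> y2 \<in> S \<Longrightarrow>
      \<bar>c y1 - c y2\<bar> \<le> (K + L * norm y2 + L * norm (y1 - y2)) * norm (y1 - y2)"
    and KL: "0 \<le> K" "0 \<le> L" "L = 0 \<or> 2 \<le> p"
    and m: "0 \<le> m" "(\<integral>\<^sup>+ y. ennreal (L * (norm y)\<^sup>2) \<partial>P) \<le> ennreal m"
    and int: "set_integrable P S c"
    and Q: "Q \<in> ambiguity_set p S (empirical n w) \<zeta>"
  shows "\<bar>(LINT y:S|Q. c y) - (LINT y:S|P. c y)\<bar> \<le> \<zeta> * (6 * (K + L * (1/2 + 2 * \<zeta>)) + 3 * m + 4 * (L * \<zeta>\<^sup>2))"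
proof -
  \<comment> \<open>Extension by 0, which is measurable on the whole space and agrees with
    \<open>c\<close> on \<open>S\<close>, where all three measures are carried.\<close>
  define c' where "c' y = indicator S y *\<^sub>R c y" for y
  have c'[measurable]: "c' \<in> borel_measurable borel"
    unfolding c'_def[abs_def] by (rule borel_measurable_indicator_continuous_on[OF S cont])
  have growth': "\<bar>c' y1 - c' y2\<bar> \<le> (K + L * norm y2 + L * norm (y1 - y2)) * norm (y1 - y2)"
    if "y1 \<in> S" "y2 \<in> S" for y1 y2
    using growth[OF that] that by (simp add: c'_def)
  have [measurable]: "S \<in> sets borel" using S by simp
  have emp: "AE y in empirical n w. y \<in> S"
    by (rule AE_empirical) (use w in auto)
  have "integrable P c'" using int by (simp add: set_integrable_def c'_def[abs_def])
  note step1 = coupling_expectation_diff[OF \<pi> P(1) c' emp P(2) _ growth' KL p \<zeta> cost m this]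
  have Q': "prob_space Q" "sets Q = sets borel" "emeasure Q S = 1" "wasserstein p Q (empirical n w) \<le> ennreal \<zeta>"
    using Q by (auto simp: ambiguity_set_def)
  have QS: "AE y in Q. y \<in> S"
    using prob_space.AE_in_set_eq_1[OF Q'(1), of S] Q' by (simp add: measure_def)
  \<comment> \<open>Doubling the radius makes the inequality strict and thereby yields a coupling,
    at the price of a constant factor.\<close>
  have "wasserstein p Q (empirical n w) < ennreal (2 * \<zeta>)"
    using Q'(4) \<zeta> by (auto intro: le_less_trans simp: ennreal_less_iff)
  then obtain \<rho> where \<rho>: "\<rho> \<in> couplings Q (empirical n w)"
    "(\<integral>\<^sup>+ u. ennreal (norm (fst u - snd u) powr p) \<partial>\<rho>) \<le> ennreal ((2 * \<zeta>) powr p)"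
    using wasserstein_less_imp_coupling[of p "2 * \<zeta>"] p \<zeta> by auto
  have m1: "0 \<le> 2 * m + 4 * (L * \<zeta>\<^sup>2)" using m KL by simp
  have "\<bar>(\<integral>y. c' y \<partial>Q) - (\<integral>y. c' y \<partial>empirical n w)\<bar>
      \<le> (2 * \<zeta>) * (2 * (K + L * (1/2 + 2 * \<zeta>)) + (2 * m + 4 * (L * \<zeta>\<^sup>2)) / 2)"
    using coupling_expectation_diff(2)[OF \<rho>(1) prob_space_empirical[OF n] c' QS emp _ growth' KL p _ \<rho>(2) m1 step1(3,1)]
      \<zeta> by auto
  moreover have "\<bar>(\<integral>y. c' y \<partial>empirical n w) - (\<integral>y. c' y \<partial>P)\<bar> \<le> \<zeta> * (2 * (K + L * (1/2 + \<zeta>)) + m / 2)"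
    using step1(2) by auto
  ultimately have "\<bar>(\<integral>y. c' y \<partial>Q) - (\<integral>y. c' y \<partial>P)\<bar>
      \<le> (2 * \<zeta>) * (2 * (K + L * (1/2 + 2 * \<zeta>)) + (2 * m + 4 * (L * \<zeta>\<^sup>2)) / 2)
        + \<zeta> * (2 * (K + L * (1/2 + \<zeta>)) + m / 2)"
    by linarith
  also have "\<dots> = \<zeta> * (2 * (2 * (K + L * (1/2 + 2 * \<zeta>)) + (2 * m + 4 * (L * \<zeta>\<^sup>2)) / 2)
        + (2 * (K + L * (1/2 + \<zeta>)) + m / 2))"
    by (simp add: algebra_simps)
  \<comment> \<open>The brackets contribute \<open>4 + 2 = 6\<close> copies of the first term, once
    \<open>\<zeta>\<close> is enlarged to \<open>2 * \<zeta>\<close> in the last bracket;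
    \<open>5/2 * m\<close> is rounded up to \<open>3 * m\<close>.\<close>
  also have "\<dots> \<le> \<zeta> * (6 * (K + L * (1/2 + 2 * \<zeta>)) + 3 * m + 4 * (L * \<zeta>\<^sup>2))"
  proof (intro mult_left_mono)
    have "0 \<le> L * \<zeta>" using KL \<zeta> by simp
    then show "2 * (2 * (K + L * (1/2 + 2 * \<zeta>)) + (2 * m + 4 * (L * \<zeta>\<^sup>2)) / 2)
        + (2 * (K + L * (1/2 + \<zeta>)) + m / 2) \<le> 6 * (K + L * (1/2 + 2 * \<zeta>)) + 3 * m + 4 * (L * \<zeta>\<^sup>2)"
      using m(1) by (simp add: distrib_left add_divide_distrib)
  qed (use \<zeta> in simp)
  finally show ?thesis
    by (simp add: set_lebesgue_integral_def c'_def)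
qed

subsection \<open>The conditional law of the response\<close>

text \<open>A product measure is determined by its values on rectangles, where independence of the
  generated algebras is the product formula.\<close>

lemma indep_rv_distr:
  fixes X :: "'s \<Rightarrow> 'x::second_countable_topology" and E :: "'s \<Rightarrow> 'y::second_countable_topology"
  assumes "prob_space N" and X[measurable]: "X \<in> borel_measurable N" and E[measurable]: "E \<in> borel_measurable N"
    and "indep_rv N X E"
  shows "distr N borel X \<Otimes>\<^sub>M distr N borel E = distr N (borel \<Otimes>\<^sub>M borel) (\<lambda>\<omega>. (X \<omega>, E \<omega>))"
proof (rule pair_measure_eqI)
  interpret prob_space N by fact
  interpret PX: prob_space "distr N borel X" by (rule prob_space_distr) simp
  interpret PE: prob_space "distr N borel E" by (rule prob_space_distr) simp
  show "sigma_finite_measure (distr N borel X)" "sigma_finite_measure (distr N borel E)" ..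
  fix A B assume "A \<in> sets (distr N borel X)" "B \<in> sets (distr N borel E)"
  then have [measurable]: "A \<in> sets borel" "B \<in> sets borel" by auto
  have "prob ((X -` A \<inter> space N) \<inter> (E -` B \<inter> space N)) = prob (X -` A \<inter> space N) * prob (E -` B \<inter> space N)"
    using \<open>indep_rv N X E\<close> unfolding indep_rv_def by (rule indep_setD) auto
  moreover have "(\<lambda>\<omega>. (X \<omega>, E \<omega>)) -` (A \<times> B) \<inter> space N = (X -` A \<inter> space N) \<inter> (E -` B \<inter> space N)"
    by auto
  ultimately show "emeasure (distr N borel X) A * emeasure (distr N borel E) B
      = emeasure (distr N (borel \<Otimes>\<^sub>M borel) (\<lambda>\<omega>. (X \<omega>, E \<omega>))) (A \<times> B)"
    by (simp add: emeasure_distr emeasure_eq_measure ennreal_mult)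
qed simp

lemma cond_law_prob_space:
  assumes "prob_space N" "E \<in> borel_measurable N"
  shows "prob_space (cond_law N E f x)"
  unfolding cond_law_def using assms by (intro prob_space.prob_space_distr) auto

lemma sets_cond_law [simp, measurable_cong]: "sets (cond_law N E f x) = sets borel"
  by (simp add: cond_law_def)

text \<open>Fubini for null sets: by independence the pair has a product law, so an almost sure
  property of \<open>f (X \<omega>) + E \<omega>\<close> holds with \<open>X \<omega>\<close> frozen
  at almost every \<open>x\<close>.\<close>

lemma AE_cond_law:
  fixes X :: "'s \<Rightarrow> 'x::second_countable_topology" and E :: "'s \<Rightarrow> 'y::euclidean_space"
  assumes "prob_space N" and [measurable]: "X \<in> borel_measurable N" "E \<in> borel_measurable N"
    and [measurable]: "f \<in> borel_measurable borel" and "indep_rv N X E"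
    and [measurable]: "Measurable.pred borel P" and AE: "AE \<omega> in N. P (f (X \<omega>) + E \<omega>)"
  shows "AE x in distr N borel X. AE y in cond_law N E f x. P y"
proof -
  interpret prob_space N by fact
  interpret PX: prob_space "distr N borel X" by (rule prob_space_distr) simp
  interpret PE: prob_space "distr N borel E" by (rule prob_space_distr) simp
  interpret pair_sigma_finite "distr N borel X" "distr N borel E" ..
  have "AE z in distr N borel X \<Otimes>\<^sub>M distr N borel E. P (f (fst z) + snd z)"
    unfolding indep_rv_distr[OF assms(1-3,5)] using AE by (subst AE_distr_iff) auto
  then have "AE x in distr N borel X. AE e in distr N borel E. P (f (fst (x, e)) + snd (x, e))"
    by (rule AE_pair)
  then show ?thesis
  proof eventually_elim
    case (elim x)
    then have "AE \<omega> in N. P (f x + E \<omega>)"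
      by (subst (asm) AE_distr_iff) auto
    then show ?case
      unfolding cond_law_def by (subst AE_distr_iff) auto
  qed
qed

text \<open>The norm of a sum is at most twice the larger norm, and
  \<open>norm e powr p \<le> exp (norm e powr a)\<close>. The conclusion holds for every
  \<open>x\<close>, without an exceptional set.\<close>

lemma cond_law_moment:
  fixes E :: "'s \<Rightarrow> 'y::euclidean_space"
  assumes "prob_space N" and [measurable]: "E \<in> borel_measurable N"
    and p: "0 \<le> p" "p \<le> a" and int: "integrable N (\<lambda>\<omega>. exp (norm (E \<omega>) powr a))"
  shows "integrable (cond_law N E f x) (\<lambda>y. norm y powr p)"
proof -
  interpret prob_space N by fact
  have powr_le: "norm (f x + e) powr p \<le> (2 * norm (f x)) powr p + 2 powr p * exp (norm e powr a)" for e :: 'y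
  proof -
    have e1: "norm e powr p \<le> exp (norm e powr a)"
    proof (cases "norm e \<le> 1")
      case True
      then have "norm e powr p \<le> 1 powr p" using p by (intro powr_mono2) auto
      also have "\<dots> \<le> exp (norm e powr a)" by simp
      finally show ?thesis .
    next
      case False
      then have "norm e powr p \<le> norm e powr a" using p by (intro powr_mono) auto
      also have "\<dots> \<le> exp (norm e powr a)"
        using exp_ge_add_one_self[of "norm e powr a"] by linarith
      finally show ?thesis .
    qed
    show ?thesis
    proof (cases "norm e \<le> norm (f x)")
      case True
      have "norm (f x + e) \<le> 2 * norm (f x)"
        using norm_triangle_ineq[of "f x" e] True by linarith
      then have "norm (f x + e) powr p \<le> (2 * norm (f x)) powr p"
        using p by (intro powr_mono2) auto
      moreover have "0 \<le> 2 powr p * exp (norm e powr a)" by simp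
      ultimately show ?thesis by linarith
    next
      case False
      have "norm (f x + e) \<le> 2 * norm e"
        using norm_triangle_ineq[of "f x" e] False by linarith
      then have "norm (f x + e) powr p \<le> (2 * norm e) powr p"
        using p by (intro powr_mono2) auto
      also have "\<dots> = 2 powr p * norm e powr p" by (simp add: powr_mult)
      also have "\<dots> \<le> 2 powr p * exp (norm e powr a)" using e1 by (intro mult_left_mono) auto
      finally have "norm (f x + e) powr p \<le> 2 powr p * exp (norm e powr a)" .
      moreover have "0 \<le> (2 * norm (f x)) powr p" by simp
      ultimately show ?thesis by linarith
    qed
  qed
  have "integrable N (\<lambda>\<omega>. norm (f x + E \<omega>) powr p)"
  proof (rule Bochner_Integration.integrable_bound)
    show "integrable N (\<lambda>\<omega>. (2 * norm (f x)) powr p + 2 powr p * exp (norm (E \<omega>) powr a))"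
      using int by auto
    show "AE \<omega> in N. norm (norm (f x + E \<omega>) powr p)
        \<le> norm ((2 * norm (f x)) powr p + 2 powr p * exp (norm (E \<omega>) powr a))"
      using powr_le by (intro AE_I2) (auto intro: order_trans abs_ge_self)
  qed simp
  then show ?thesis
    unfolding cond_law_def by (subst integrable_distr_eq) auto
qed

subsection \<open>Rate of convergence\<close>

text \<open>The bad event is a union of four: the null event that some point leaves
  \<open>S\<close>, the two regression failures of probability at most \<open>\<beta>\<close>, and
  the concentration failure of probability at most \<open>\<gamma>\<close>.\<close>

lemma residual_coupling_event:
  fixes f :: "'x::euclidean_space \<Rightarrow> 'y::euclidean_space" and h :: "'w \<Rightarrow> 'x \<Rightarrow> 'y"
  assumes "prob_space M" and n: "n \<ge> 1" and p: "1 \<le> p" and S: "convex S" "closed S"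
    and [measurable]: "f \<in> borel_measurable borel" "\<And>i. \<xi> i \<in> borel_measurable M"
      "(\<lambda>\<omega>. h \<omega> x) \<in> borel_measurable M" "\<And>i. (\<lambda>\<omega>. h \<omega> (\<xi> i \<omega>)) \<in> borel_measurable M"
    and in_S: "\<And>i. AE \<omega> in M. f x + (y i \<omega> - f (\<xi> i \<omega>)) \<in> S"
    and k: "0 < k" "\<P>(\<omega> in M. norm (f x - h \<omega> x) powr p > k powr p) \<le> \<beta>"
      "\<P>(\<omega> in M. 1 / real n * (\<Sum>i<n. norm (f (\<xi> i \<omega>) - h \<omega> (\<xi> i \<omega>)) powr p) > k powr p) \<le> \<beta>"
    and r: "0 < r" "(\<lambda>\<omega>. wasserstein p (empirical n (\<lambda>i. f x + (y i \<omega> - f (\<xi> i \<omega>)))) P) \<in> borel_measurable M"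
      "\<P>(\<omega> in M. wasserstein p (empirical n (\<lambda>i. f x + (y i \<omega> - f (\<xi> i \<omega>)))) P \<ge> ennreal r) \<le> \<gamma>"
  shows "\<exists>B\<in>sets M. measure M B \<le> 2 * \<beta> + \<gamma> \<and> (\<forall>\<omega>\<in>space M - B.
    \<exists>\<pi>\<in>couplings (empirical n (\<lambda>i. closest_point S (h \<omega> x + (y i \<omega> - h \<omega> (\<xi> i \<omega>))))) P.
      (\<integral>\<^sup>+ q. ennreal (norm (fst q - snd q) powr p) \<partial>\<pi>) \<le> ennreal ((2 * k + r) powr p))"
proof -
  interpret prob_space M by fact
  note r(2)[measurable]
  define A1 where "A1 = {\<omega>\<in>space M. norm (f x - h \<omega> x) powr p > k powr p}"
  define A2 where "A2 = {\<omega>\<in>space M. 1 / real n * (\<Sum>i<n. norm (f (\<xi> i \<omega>) - h \<omega> (\<xi> i \<omega>)) powr p) > k powr p}"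
  define A3 where "A3 = {\<omega>\<in>space M. wasserstein p (empirical n (\<lambda>i. f x + (y i \<omega> - f (\<xi> i \<omega>)))) P \<ge> ennreal r}"
  have A[measurable]: "A1 \<in> sets M" "A2 \<in> sets M" "A3 \<in> sets M"
    unfolding A1_def A2_def A3_def by measurable
  have "AE \<omega> in M. \<forall>i\<in>UNIV. f x + (y i \<omega> - f (\<xi> i \<omega>)) \<in> S"
    using in_S by (subst AE_ball_countable) auto
  then obtain A0 where A0: "{\<omega>\<in>space M. \<not> (\<forall>i. f x + (y i \<omega> - f (\<xi> i \<omega>)) \<in> S)} \<subseteq> A0"
    "emeasure M A0 = 0" "A0 \<in> sets M"
    by (auto elim!: AE_E)
  have sub: "measure M (A \<union> B) \<le> measure M A + measure M B" if "A \<in> sets M" "B \<in> sets M" for A B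
    using that by (rule measure_Un_le)
  have "measure M (A0 \<union> A1 \<union> A2 \<union> A3) \<le> measure M A0 + measure M A1 + measure M A2 + measure M A3"
    using sub[of "A0 \<union> A1 \<union> A2" A3] sub[of "A0 \<union> A1" A2]
      sub[of A0 A1] A A0(3) by auto
  moreover have "measure M A0 = 0" using A0 by (simp add: measure_def)
  ultimately have "measure M (A0 \<union> A1 \<union> A2 \<union> A3) \<le> 2 * \<beta> + \<gamma>"
    using k(2,3) r(3) unfolding A1_def[symmetric] A2_def[symmetric] A3_def[symmetric] by linarith
  moreover have "\<exists>\<pi>\<in>couplings (empirical n (\<lambda>i. closest_point S (h \<omega> x + (y i \<omega> - h \<omega> (\<xi> i \<omega>))))) P.
      (\<integral>\<^sup>+ q. ennreal (norm (fst q - snd q) powr p) \<partial>\<pi>) \<le> ennreal ((2 * k + r) powr p)"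
    if \<omega>: "\<omega> \<in> space M - (A0 \<union> A1 \<union> A2 \<union> A3)" for \<omega>
  proof -
    have "norm (f x - h \<omega> x) powr p \<le> k powr p"
      using \<omega> by (auto simp: A1_def not_less)
    then have *: "norm (f x - h \<omega> x) \<le> k"
      using p k(1) powr_less_mono2[of p k "norm (f x - h \<omega> x)"] by (auto simp: not_less[symmetric])
    have **: "1 / real n * (\<Sum>i<n. norm (f (\<xi> i \<omega>) - h \<omega> (\<xi> i \<omega>)) powr p) \<le> k powr p"
      using \<omega> by (auto simp: A2_def not_less)
    have ***: "wasserstein p (empirical n (\<lambda>i. f x + (y i \<omega> - f (\<xi> i \<omega>)))) P < ennreal r"
      using \<omega> by (auto simp: A3_def not_le)
    have "f x + (y i \<omega> - f (\<xi> i \<omega>)) \<in> S" for i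
      using \<omega> A0(1) by blast
    then obtain \<pi> where "\<pi> \<in> couplings (empirical n (\<lambda>i. closest_point S (h \<omega> x + (y i \<omega> - h \<omega> (\<xi> i \<omega>))))) P"
      "(\<integral>\<^sup>+ q. ennreal (norm (fst q - snd q) powr p) \<partial>\<pi>) \<le> ennreal ((2 * k + r) powr p)"
      by (rule residual_coupling[OF n p S _ k(1) * ** r(1) ***])
    then show ?thesis by blast
  qed
  ultimately show ?thesis
    using A A0(3) by (intro bexI[of _ "A0 \<union> A1 \<union> A2 \<union> A3"]) auto
qed

text \<open>Since \<open>P\<close> competes in the supremum, the robust objective dominates the true
  one at \<open>zh\<close>, and optimality of \<open>zh\<close> moves the comparison to
  \<open>z0\<close>. The deviation \<open>D\<close> therefore concerns the single decision
  \<open>z0\<close>.\<close>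

lemma dro_sandwich:
  assumes P: "P \<in> ambiguity_set p \<Y> Phat \<zeta>"
    and z0: "z0 \<in> Z" "\<And>z. z \<in> Z \<Longrightarrow> expected_cost \<Y> c P z0 \<le> expected_cost \<Y> c P z"
    and bdd: "\<And>z. z \<in> Z \<Longrightarrow> bdd_above ((\<lambda>Q. expected_cost \<Y> c Q z) ` ambiguity_set p \<Y> Phat \<zeta>)"
    and zh: "zh \<in> Z" "\<And>z. z \<in> Z \<Longrightarrow> dro_objective p \<Y> c Phat \<zeta> zh \<le> dro_objective p \<Y> c Phat \<zeta> z"
    and D: "\<And>Q. Q \<in> ambiguity_set p \<Y> Phat \<zeta> \<Longrightarrow> \<bar>expected_cost \<Y> c Q z0 - expected_cost \<Y> c P z0\<bar> \<le> D"
  shows "\<bar>(INF z\<in>Z. dro_objective p \<Y> c Phat \<zeta> z) - (INF z\<in>Z. expected_cost \<Y> c P z)\<bar> \<le> D"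
    and "\<bar>expected_cost \<Y> c P zh - (INF z\<in>Z. expected_cost \<Y> c P z)\<bar> \<le> D"
proof -
  have v: "(INF z\<in>Z. expected_cost \<Y> c P z) = expected_cost \<Y> c P z0"
    using z0 by (intro cInf_eq_minimum) auto
  have vd: "(INF z\<in>Z. dro_objective p \<Y> c Phat \<zeta> z) = dro_objective p \<Y> c Phat \<zeta> zh"
    using zh by (intro cInf_eq_minimum) auto
  \<comment> \<open>Boundedness is essential here: a real supremum is an upper bound only for a set
    that is bounded above.\<close>
  have "expected_cost \<Y> c P zh \<le> dro_objective p \<Y> c Phat \<zeta> zh"
    unfolding dro_objective_def using P bdd[OF zh(1)] by (intro cSUP_upper)
  moreover have "dro_objective p \<Y> c Phat \<zeta> z0 \<le> expected_cost \<Y> c P z0 + D"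
    unfolding dro_objective_def using P
  proof (intro cSUP_least)
    fix Q assume "Q \<in> ambiguity_set p \<Y> Phat \<zeta>"
    then show "expected_cost \<Y> c Q z0 \<le> expected_cost \<Y> c P z0 + D"
      using D[of Q] by linarith
  qed auto
  moreover have "expected_cost \<Y> c P z0 \<le> expected_cost \<Y> c P zh"
    "dro_objective p \<Y> c Phat \<zeta> zh \<le> dro_objective p \<Y> c Phat \<zeta> z0"
    using z0 zh by auto
  ultimately show "\<bar>(INF z\<in>Z. dro_objective p \<Y> c Phat \<zeta> z) - (INF z\<in>Z. expected_cost \<Y> c P z)\<bar> \<le> D"
    and "\<bar>expected_cost \<Y> c P zh - (INF z\<in>Z. expected_cost \<Y> c P z)\<bar> \<le> D"
    unfolding v vd by linarith+
qed

text \<open>The quotient \<open>V n \<omega> / W n\<close> is the factor bounded in probability, as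
  it exceeds \<open>K\<close> only on the exceptional event.\<close>

lemma big_Op_deterministicI:
  fixes V :: "nat \<Rightarrow> 'w \<Rightarrow> real"
  assumes "prob_space M" and W: "\<And>n. n \<ge> 1 \<Longrightarrow> 0 < W n"
    and V: "\<And>n. n \<ge> 1 \<Longrightarrow> V n \<in> borel_measurable M" and "\<beta> \<longlonglongrightarrow> 0"
    and B: "\<And>n. n \<ge> 1 \<Longrightarrow> \<exists>B\<in>sets M. measure M B \<le> \<beta> n \<and> (\<forall>\<omega>\<in>space M - B. \<bar>V n \<omega>\<bar> \<le> K * W n)"
  shows "big_Op M V (\<lambda>n \<omega>. W n)"
  unfolding big_Op_def
proof (intro exI conjI)
  interpret prob_space M by fact
  show "bounded_in_prob M (\<lambda>n \<omega>. V n \<omega> / W n)"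
  proof (rule bounded_in_probI[OF \<open>prob_space M\<close> _ \<open>\<beta> \<longlonglongrightarrow> 0\<close>])
    fix n :: nat assume n: "n \<ge> 1"
    show "(\<lambda>\<omega>. V n \<omega> / W n) \<in> borel_measurable M"
      using V[OF n] by simp
    obtain B' where B': "B' \<in> sets M" "measure M B' \<le> \<beta> n"
      "\<And>\<omega>. \<omega> \<in> space M - B' \<Longrightarrow> \<bar>V n \<omega>\<bar> \<le> K * W n"
      using B[OF n] by blast
    have "{\<omega>\<in>space M. \<bar>V n \<omega> / W n\<bar> > K} \<subseteq> B'"
    proof
      fix \<omega> assume \<omega>: "\<omega> \<in> {\<omega>\<in>space M. \<bar>V n \<omega> / W n\<bar> > K}"
      then have "K * W n < \<bar>V n \<omega>\<bar>"
        using W[OF n] by (simp add: abs_divide pos_less_divide_eq)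
      then show "\<omega> \<in> B'"
        using B'(3)[of \<omega>] \<omega> by auto
    qed
    then have "prob {\<omega>\<in>space M. \<bar>V n \<omega> / W n\<bar> > K} \<le> prob B'"
      using B'(1) by (intro finite_measure_mono)
    then show "prob {\<omega>\<in>space M. \<bar>V n \<omega> / W n\<bar> > K} \<le> \<beta> n"
      using B'(2) by linarith
  qed
  show "\<forall>n\<ge>1. \<forall>\<omega>\<in>space M. V n \<omega> = V n \<omega> / W n * W n"
    using W by (auto simp: less_imp_neq[symmetric])
qed

theorem theorem10:
  fixes N :: "'s measure" and M :: "'w measure"
    and X :: "'s \<Rightarrow> 'x::euclidean_space" and Y \<epsilon> :: "'s \<Rightarrow> 'y::euclidean_space"
    and f :: "'x \<Rightarrow> 'y"
    and xs :: "nat \<Rightarrow> 'w \<Rightarrow> 'x" and ys :: "nat \<Rightarrow> 'w \<Rightarrow> 'y"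
    and regr :: "nat \<Rightarrow> (nat \<Rightarrow> 'y \<times> 'x) \<Rightarrow> 'x \<Rightarrow> 'y"
    and \<X> :: "'x set" and \<Y> :: "'y set"
    and Z :: "'z::euclidean_space set" and c :: "'z \<Rightarrow> 'y \<Rightarrow> real"
    and zhat :: "nat \<Rightarrow> 'w \<Rightarrow> 'x \<Rightarrow> 'z"
    and p a C c0 Bcp :: real
    and \<kappa> :: "nat \<Rightarrow> real \<Rightarrow> 'x \<Rightarrow> real" and \<alpha> :: "nat \<Rightarrow> real"
  defines "PX \<equiv> distr N borel X"
    and "g \<equiv> (\<lambda>z x. expected_cost \<Y> c (cond_law N \<epsilon> f x) z)"
    and "eps \<equiv> (\<lambda>i \<omega>. ys i \<omega> - f (xs i \<omega>))"
    and "fhat \<equiv> (\<lambda>n \<omega>. regr n (data ys xs n \<omega>))"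
    and "\<zeta> \<equiv> (\<lambda>n x. radius DIM('y) p a C c0 \<kappa> n (\<alpha> n) x)"
  defines "obj \<equiv> (\<lambda>n \<omega> x r. dro_objective p \<Y> c (residual_empirical \<Y> fhat ys xs n \<omega> x) r)"
    and "vstar \<equiv> (\<lambda>x. INF z\<in>Z. g z x)"  \<comment> \<open>a minimum, by compactness and lower semicontinuity\<close>
  defines "vDRO \<equiv> (\<lambda>n \<omega> x. INF z\<in>Z. obj n \<omega> x (\<zeta> n x) z)"
  \<comment> \<open>model\<close>
  assumes "prob_space N" and "X \<in> borel_measurable N" and "\<epsilon> \<in> borel_measurable N"
    and "\<And>\<omega>. Y \<omega> = f (X \<omega>) + \<epsilon> \<omega>"
    and "regression_function N X Y f"
    and "indep_rv N X \<epsilon>" and "integrable N \<epsilon>" and "(\<integral>\<omega>. \<epsilon> \<omega> \<partial>N) = 0"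
    and "\<X> = law_support PX"
    and "\<Y> = law_support (distr N borel Y)" and "\<Y> \<noteq> {}" and "convex \<Y>"
  \<comment> \<open>true problem\<close>
    and "Z \<noteq> {}" and "compact Z"
    and "\<And>z. z \<in> Z \<Longrightarrow> AE x in PX. set_integrable (cond_law N \<epsilon> f x) \<Y> (c z)"
    and "AE x in PX. lsc_on Z (\<lambda>z. g z x)"
  \<comment> \<open>data and regression estimate\<close>
    and "prob_space M"
    and "\<And>i. xs i \<in> borel_measurable M" and "\<And>i. ys i \<in> borel_measurable M"
    and "\<And>i. distr M (borel \<Otimes>\<^sub>M borel) (\<lambda>\<omega>. (ys i \<omega>, xs i \<omega>)) =
              distr N (borel \<Otimes>\<^sub>M borel) (\<lambda>\<omega>. (Y \<omega>, X \<omega>))"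
    and "\<And>n. n \<ge> 1 \<Longrightarrow> (\<lambda>(D, x). regr n D x) \<in>
              borel_measurable ((\<Pi>\<^sub>M i\<in>{..<n}. borel \<Otimes>\<^sub>M borel) \<Otimes>\<^sub>M borel)"
  \<comment> \<open>ER-DRO problem: objective and optimal solutions\<close>
    and "\<And>n \<omega> x r z. n \<ge> 1 \<Longrightarrow> \<omega> \<in> space M \<Longrightarrow> x \<in> \<X> \<Longrightarrow> r \<ge> 0 \<Longrightarrow> z \<in> Z \<Longrightarrow>
           bdd_above ((\<lambda>Q. expected_cost \<Y> c Q z) `
                        ambiguity_set p \<Y> (residual_empirical \<Y> fhat ys xs n \<omega> x) r)"
    and "\<And>n \<omega> x r. n \<ge> 1 \<Longrightarrow> \<omega> \<in> space M \<Longrightarrow> x \<in> \<X> \<Longrightarrow> r \<ge> 0 \<Longrightarrow> lsc_on Z (obj n \<omega> x r)"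
    and "AE x in PX. \<forall>n\<ge>1. (\<lambda>\<omega>. vDRO n \<omega> x) \<in> borel_measurable M"
    and "AE x in PX. \<forall>n\<ge>1. (\<lambda>\<omega>. zhat n \<omega> x) \<in> borel_measurable M \<and>
           (\<forall>\<omega>\<in>space M. zhat n \<omega> x \<in> Z \<and>
              (\<forall>z\<in>Z. obj n \<omega> x (\<zeta> n x) (zhat n \<omega> x) \<le> obj n \<omega> x (\<zeta> n x) z))"
  \<comment> \<open>the quoted concentration inequality, which specifies the constants \<open>C\<close> and \<open>c0\<close>\<close>
    and "C \<ge> 1" and "c0 > 0"
    and "\<And>n x. n \<ge> 1 \<Longrightarrow> x \<in> \<X> \<Longrightarrow>
           (\<lambda>\<omega>. wasserstein p (error_empirical f ys xs n \<omega> x) (cond_law N \<epsilon> f x)) \<in> borel_measurable M"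
    and "\<And>n x k. n \<ge> 1 \<Longrightarrow> x \<in> \<X> \<Longrightarrow> k > 0 \<Longrightarrow>
           \<P>(\<omega> in M. wasserstein p (error_empirical f ys xs n \<omega> x) (cond_law N \<epsilon> f x) \<ge> ennreal k)
             \<le> concentration_bound DIM('y) p a C c0 n k"
  \<comment> \<open>hypotheses of the theorem\<close>
    and "1 \<le> p" and "p \<noteq> real DIM('y) / 2"
    and i: "a > p" "integrable N (\<lambda>\<omega>. exp (norm (\<epsilon> \<omega>) powr a))"
    and ii: "AE x in PX. \<forall>n\<ge>1. \<forall>\<beta>\<in>{0<..<1}. \<kappa> n \<beta> x > 0 \<and>
           \<P>(\<omega> in M. norm (f x - fhat n \<omega> x) powr p > \<kappa> n \<beta> x powr p) \<le> \<beta> \<and>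
           \<P>(\<omega> in M. 1 / real n * (\<Sum>i<n. norm (f (xs i \<omega>) - fhat n \<omega> (xs i \<omega>)) powr p)
                        > \<kappa> n \<beta> x powr p) \<le> \<beta>"
    and iii: "\<And>y. y \<in> \<Y> \<Longrightarrow> lsc_on Z (\<lambda>z. c z y)"
          "\<And>z. z \<in> Z \<Longrightarrow> continuous_on \<Y> (c z)"
          "Bcp \<ge> 0"
          "\<And>z y. z \<in> Z \<Longrightarrow> y \<in> \<Y> \<Longrightarrow> \<bar>c z y\<bar> \<le> Bcp * (1 + norm y powr p)"
    and iv: "\<And>n. n \<ge> 1 \<Longrightarrow> 0 < \<alpha> n \<and> \<alpha> n < 1" "summable \<alpha>"
          "AE x in PX. (\<lambda>n. \<zeta> n x) \<longlonglongrightarrow> 0"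
    and v: "prob_space.indep_vars M (\<lambda>_. borel) eps UNIV"
          "\<And>i j. distr M borel (eps i) = distr M borel (eps j)"
    and vi: "(\<exists>L1. \<forall>z\<in>Z. (L1 z)-lipschitz_on \<Y> (c z)) \<or>
             (2 \<le> p \<and> (\<exists>grad L2. \<forall>z\<in>Z.
                (\<forall>y\<in>\<Y>. (c z has_derivative (\<lambda>h. grad z y \<bullet> h)) (at y within \<Y>)) \<and>
                (AE x in PX. set_integrable (cond_law N \<epsilon> f x) \<Y> (\<lambda>y. (norm (grad z y))\<^sup>2)) \<and>
                (\<forall>y\<in>\<Y>. \<forall>y'\<in>\<Y>. norm (grad z y' - grad z y) \<le> L2 z * norm (y' - y))))"
  shows "AE x in PX.
           big_Op M (\<lambda>n \<omega>. \<bar>vDRO n \<omega> x - vstar x\<bar>) (\<lambda>n \<omega>. \<zeta> n x) \<and>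
           big_Op M (\<lambda>n \<omega>. \<bar>g (zhat n \<omega> x) x - vstar x\<bar>) (\<lambda>n \<omega>. \<zeta> n x)"
proof -
  note X[measurable] = assms(10) and \<epsilon>[measurable] = assms(11)
  note xs[measurable] = assms(26) and ys[measurable] = assms(27)
  have f[measurable]: "f \<in> borel_measurable borel"
    using assms(13) by (simp add: regression_function_def)
  interpret N: prob_space N by (rule assms(9))
  interpret M: prob_space M by (rule assms(25))
  have Y_eq: "Y = (\<lambda>\<omega>. f (X \<omega>) + \<epsilon> \<omega>)"
    using assms(12) by blast
  have Y[measurable]: "Y \<in> borel_measurable N"
    unfolding Y_eq by measurable
  have \<Y>_closed: "closed \<Y>"
    unfolding assms(18) by (rule closed_law_support)
  then have [measurable]: "\<Y> \<in> sets borel" by simp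
  have "AE y in distr N borel Y. y \<in> \<Y>"
    unfolding assms(18) by (rule AE_in_law_support) simp
  then have "AE \<omega> in N. f (X \<omega>) + \<epsilon> \<omega> \<in> \<Y>"
    by (simp add: AE_distr_iff Y_eq)
  then have supp_Y: "AE x in PX. AE y in cond_law N \<epsilon> f x. y \<in> \<Y>"
    unfolding PX_def by (intro AE_cond_law[OF assms(9) X \<epsilon> f assms(14)]) auto
  have supp_X: "AE x in PX. x \<in> \<X>"
    unfolding assms(17) by (rule AE_in_law_support) (simp add: PX_def)
  \<comment> \<open>Joint measurability of the regression map in data and argument covers both the
    fixed point \<open>x\<close> and the random covariates.\<close>
  have fhat_measurable: "(\<lambda>\<omega>. fhat n \<omega> (\<xi> \<omega>)) \<in> borel_measurable M"
    if n: "n \<ge> 1" and [measurable]: "\<xi> \<in> borel_measurable M" for n \<xi>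
  proof -
    have [measurable]: "data ys xs n \<in> M \<rightarrow>\<^sub>M (\<Pi>\<^sub>M i\<in>{..<n}. borel \<Otimes>\<^sub>M borel)"
      unfolding data_def[abs_def] by measurable
    have "(\<lambda>\<omega>. (\<lambda>(D, x). regr n D x) (data ys xs n \<omega>, \<xi> \<omega>)) \<in> borel_measurable M"
      by (rule measurable_compose[OF _ assms(29)[OF n]]) measurable
    then show ?thesis by (simp add: fhat_def)
  qed
  have growth: "\<exists>K L. 0 \<le> K \<and> 0 \<le> L \<and> (L = 0 \<or> 2 \<le> p) \<and> (\<forall>y1\<in>\<Y>. \<forall>y2\<in>\<Y>.
      \<bar>c z y1 - c z y2\<bar> \<le> (K + L * norm y2 + L * norm (y1 - y2)) * norm (y1 - y2))"
    if z: "z \<in> Z" for z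
    using vi
  proof
    assume "\<exists>L1. \<forall>z\<in>Z. (L1 z)-lipschitz_on \<Y> (c z)"
    then obtain K where K: "K-lipschitz_on \<Y> (c z)" using z by blast
    have "0 \<le> K" using K by (rule lipschitz_on_nonneg)
    moreover have "\<bar>c z y1 - c z y2\<bar> \<le> (K + 0 * norm y2 + 0 * norm (y1 - y2)) * norm (y1 - y2)"
      if "y1 \<in> \<Y>" "y2 \<in> \<Y>" for y1 y2
      using lipschitz_onD[OF K that] by (simp add: dist_norm)
    ultimately show ?thesis by blast
  next
    assume *: "2 \<le> p \<and> (\<exists>grad L2. \<forall>z\<in>Z.
                (\<forall>y\<in>\<Y>. (c z has_derivative (\<lambda>h. grad z y \<bullet> h)) (at y within \<Y>)) \<and>
                (AE x in PX. set_integrable (cond_law N \<epsilon> f x) \<Y> (\<lambda>y. (norm (grad z y))\<^sup>2)) \<and>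
                (\<forall>y\<in>\<Y>. \<forall>y'\<in>\<Y>. norm (grad z y' - grad z y) \<le> L2 z * norm (y' - y)))"
    then obtain G :: "'y \<Rightarrow> 'y" and L where
      G: "\<And>y. y \<in> \<Y> \<Longrightarrow> (c z has_derivative (\<lambda>h. G y \<bullet> h)) (at y within \<Y>)"
         "\<And>y y'. y \<in> \<Y> \<Longrightarrow> y' \<in> \<Y> \<Longrightarrow> norm (G y' - G y) \<le> L * norm (y' - y)"
      using z by blast
    then show ?thesis
      using gradient_growth[OF assms(20) G] * by blast
  qed
  show ?thesis
    \<comment> \<open>These properties hold off one null set for all decisions at once, so they
      survive the choice of a minimizer that depends on \<open>x\<close>.\<close>
    using supp_X supp_Y assms(24) assms(32) assms(33) ii iv(3)
  proof eventually_elim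
    case (elim x)
    define P where "P = cond_law N \<epsilon> f x"
    have P: "prob_space P" "AE y in P. y \<in> \<Y>"
      unfolding P_def using cond_law_prob_space[OF assms(9) \<epsilon>] elim(2) by auto
    have [measurable_cong]: "sets P = sets borel"
      by (simp add: P_def)
    interpret P: prob_space P by fact
    have g_eq: "g z x = expected_cost \<Y> c P z" for z
      by (simp add: g_def P_def)
    obtain z0 where z0: "z0 \<in> Z" "\<And>z. z \<in> Z \<Longrightarrow> g z0 x \<le> g z x"
      using lsc_on_attains_min[OF assms(22,21) elim(3)] by blast
    obtain K L where KL: "0 \<le> K" "0 \<le> L" "L = 0 \<or> 2 \<le> p"
      and gr: "\<And>y1 y2. y1 \<in> \<Y> \<Longrightarrow> y2 \<in> \<Y> \<Longrightarrow>
        \<bar>c z0 y1 - c z0 y2\<bar> \<le> (K + L * norm y2 + L * norm (y1 - y2)) * norm (y1 - y2)"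
      using growth[OF z0(1)] by blast
    have moment: "integrable P (\<lambda>y. norm y powr p)"
      unfolding P_def using assms(38) i by (intro cond_law_moment[OF assms(9) \<epsilon>, of p a]) auto
    have "integrable P (\<lambda>y. L * (norm y)\<^sup>2)"
    proof (rule Bochner_Integration.integrable_bound)
      show "integrable P (\<lambda>y. L * (1 + norm y powr p))"
        using moment by auto
      have "L * (norm y)\<^sup>2 \<le> L * (1 + norm y powr p)" for y :: 'y
        using KL square_le_one_plus_powr[OF _ norm_ge_zero] by (auto intro: mult_left_mono)
      then show "AE y in P. norm (L * (norm y)\<^sup>2) \<le> norm (L * (1 + norm y powr p))"
        using KL by (intro AE_I2) (auto simp: abs_mult)
    qed simp
    then have "(\<integral>\<^sup>+ y. ennreal (L * (norm y)\<^sup>2) \<partial>P) = ennreal (\<integral>y. L * (norm y)\<^sup>2 \<partial>P)"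
      using KL by (intro nn_integral_eq_integral) auto
    then obtain m where m: "0 \<le> m" "(\<integral>\<^sup>+ y. ennreal (L * (norm y)\<^sup>2) \<partial>P) \<le> ennreal m"
      using KL that[of "\<integral>y. L * (norm y)\<^sup>2 \<partial>P"] by simp
    \<comment> \<open>The growth bound together with the \<open>p\<close>-th moment gives
      integrability for every decision, in particular for \<open>z0\<close>.\<close>
    have int: "set_integrable P \<Y> (c z0)"
      unfolding set_integrable_def
    proof (rule Bochner_Integration.integrable_bound)
      show "integrable P (\<lambda>y. Bcp * (1 + norm y powr p))"
        using moment by auto
      have "(\<lambda>y. indicator \<Y> y *\<^sub>R c z0 y) \<in> borel_measurable borel"
        using \<Y>_closed iii(2)[OF z0(1)] by (rule borel_measurable_indicator_continuous_on)
      then show "(\<lambda>y. indicator \<Y> y *\<^sub>R c z0 y) \<in> borel_measurable P" by measurable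
      show "AE y in P. norm (indicator \<Y> y *\<^sub>R c z0 y) \<le> norm (Bcp * (1 + norm y powr p))"
        using iii(3) iii(4)[OF z0(1)]
        by (intro AE_I2) (auto simp: indicator_def abs_mult)
    qed
    have \<alpha>: "0 < \<alpha> n" "\<alpha> n < 1" if "n \<ge> 1" for n
      using iv(1)[OF that] by auto
    have \<kappa>: "0 < \<kappa> n (\<alpha> n / 4) x"
      "\<P>(\<omega> in M. norm (f x - fhat n \<omega> x) powr p > \<kappa> n (\<alpha> n / 4) x powr p) \<le> \<alpha> n / 4"
      "\<P>(\<omega> in M. 1 / real n * (\<Sum>i<n. norm (f (xs i \<omega>) - fhat n \<omega> (xs i \<omega>)) powr p)
                        > \<kappa> n (\<alpha> n / 4) x powr p) \<le> \<alpha> n / 4" if "n \<ge> 1" for n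
    proof -
      have "\<alpha> n / 4 \<in> {0<..<1}" using \<alpha>[OF that] by auto
      then show "0 < \<kappa> n (\<alpha> n / 4) x"
        "\<P>(\<omega> in M. norm (f x - fhat n \<omega> x) powr p > \<kappa> n (\<alpha> n / 4) x powr p) \<le> \<alpha> n / 4"
        "\<P>(\<omega> in M. 1 / real n * (\<Sum>i<n. norm (f (xs i \<omega>) - fhat n \<omega> (xs i \<omega>)) powr p)
                        > \<kappa> n (\<alpha> n / 4) x powr p) \<le> \<alpha> n / 4"
        using elim(6) that by blast+
    qed
    define r where "r n = kappa2 DIM('y) p a C c0 n (\<alpha> n)" for n
    have r: "0 < r n" if "n \<ge> 1" for n
      unfolding r_def using kappa2_pos[OF assms(35,34) \<alpha>[OF that] that] .
    have \<zeta>_eq: "\<zeta> n x = 2 * \<kappa> n (\<alpha> n / 4) x + r n" for n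
      by (simp add: \<zeta>_def radius_def r_def)
    have \<zeta>_pos: "0 < \<zeta> n x" if "n \<ge> 1" for n
      using \<kappa>(1)[OF that] r[OF that] by (simp add: \<zeta>_eq)
    \<comment> \<open>A convergent sequence of radii is bounded; inserting \<open>b\<close> for the
      radius in the comparison constant gives \<open>C1\<close>, which does not depend on
      \<open>n\<close>.\<close>
    obtain b where b: "\<And>n. \<zeta> n x \<le> b"
      using convergent_imp_Bseq[OF convergentI[OF elim(7)]] unfolding Bseq_def
      by (metis abs_le_D1 real_norm_def)
    define C1 where "C1 = 6 * (K + L * (1/2 + 2 * b)) + 3 * m + 4 * (L * b\<^sup>2)"
    \<comment> \<open>An observation has the joint law of \<open>(Y, X)\<close>, so its error is
      distributed as \<open>\<epsilon>\<close>.\<close>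
    have in_\<Y>: "AE \<omega> in M. f x + (ys k \<omega> - f (xs k \<omega>)) \<in> \<Y>" for k
    proof -
      have "AE \<omega> in N. f x + \<epsilon> \<omega> \<in> \<Y>"
        using elim(2) unfolding cond_law_def by (subst (asm) AE_distr_iff) auto
      then have "AE w in distr N (borel \<Otimes>\<^sub>M borel) (\<lambda>\<omega>. (Y \<omega>, X \<omega>)). f x + (fst w - f (snd w)) \<in> \<Y>"
        by (subst AE_distr_iff) (auto simp: Y_eq)
      then show ?thesis
        unfolding assms(28)[of k, symmetric] by (subst (asm) AE_distr_iff) auto
    qed
    have good: "\<exists>B\<in>sets M. measure M B \<le> \<alpha> n \<and> (\<forall>\<omega>\<in>space M - B.
        \<bar>vDRO n \<omega> x - vstar x\<bar> \<le> C1 * \<zeta> n x \<and> \<bar>g (zhat n \<omega> x) x - vstar x\<bar> \<le> C1 * \<zeta> n x)"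
      if n: "n \<ge> 1" for n
    proof -
      have conc: "(\<lambda>\<omega>. wasserstein p (empirical n (\<lambda>i. f x + (ys i \<omega> - f (xs i \<omega>)))) P) \<in> borel_measurable M"
        "\<P>(\<omega> in M. wasserstein p (empirical n (\<lambda>i. f x + (ys i \<omega> - f (xs i \<omega>)))) P \<ge> ennreal (r n)) \<le> \<alpha> n / 2"
        using assms(36)[OF n elim(1)] assms(37)[OF n elim(1) r[OF n]]
          concentration_bound_kappa2[OF assms(35,34) \<alpha>[OF n] n, of p a "DIM('y)"] assms(38) i(1)
        by (simp_all add: error_empirical_def P_def r_def)
      \<comment> \<open>The risk level is split into a quarter for each regression failure and a
        half for the concentration failure. The radii add up in the same way to
        \<open>\<zeta> n x\<close>.\<close>
      obtain B where B: "B \<in> sets M" "measure M B \<le> 2 * (\<alpha> n / 4) + \<alpha> n / 2"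
        "\<And>\<omega>. \<omega> \<in> space M - B \<Longrightarrow> \<exists>\<pi>\<in>couplings (residual_empirical \<Y> fhat ys xs n \<omega> x) P.
          (\<integral>\<^sup>+ q. ennreal (norm (fst q - snd q) powr p) \<partial>\<pi>) \<le> ennreal (\<zeta> n x powr p)"
        using residual_coupling_event[OF assms(25) n assms(38,20) \<Y>_closed f xs fhat_measurable[OF n]
            fhat_measurable[OF n xs] in_\<Y> \<kappa>[OF n] r[OF n] conc]
        unfolding residual_empirical_def \<zeta>_eq by auto
      have "\<bar>vDRO n \<omega> x - vstar x\<bar> \<le> C1 * \<zeta> n x \<and> \<bar>g (zhat n \<omega> x) x - vstar x\<bar> \<le> C1 * \<zeta> n x"
        if \<omega>: "\<omega> \<in> space M - B" for \<omega>
      proof -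
        define w where "w i = closest_point \<Y> (fhat n \<omega> x + (ys i \<omega> - fhat n \<omega> (xs i \<omega>)))" for i
        have Phat: "residual_empirical \<Y> fhat ys xs n \<omega> x = empirical n w"
          by (simp add: residual_empirical_def w_def[abs_def])
        have w: "w i \<in> \<Y>" for i
          unfolding w_def using \<Y>_closed assms(19) by (rule closest_point_in_set)
        obtain \<pi> where \<pi>: "\<pi> \<in> couplings (empirical n w) P"
          "(\<integral>\<^sup>+ q. ennreal (norm (fst q - snd q) powr p) \<partial>\<pi>) \<le> ennreal (\<zeta> n x powr p)"
          using B(3)[OF \<omega>] unfolding Phat by blast
        have "wasserstein p P (empirical n w) \<le> ennreal (\<zeta> n x)"
          using coupling_swap[OF \<pi>(1)] \<pi>(2) assms(38) \<zeta>_pos[OF n]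
          by (intro wasserstein_leI[where \<pi> = "distr \<pi> (borel \<Otimes>\<^sub>M borel) prod.swap"]) auto
        moreover have "emeasure P \<Y> = 1"
          using P(2) P.AE_in_set_eq_1[of \<Y>] by (simp add: P.emeasure_eq_measure)
        ultimately have P_in: "P \<in> ambiguity_set p \<Y> (empirical n w) (\<zeta> n x)"
          using P(1) by (simp add: ambiguity_set_def P_def)
        have diff: "\<bar>expected_cost \<Y> c Q z0 - expected_cost \<Y> c P z0\<bar> \<le> C1 * \<zeta> n x"
          if Q: "Q \<in> ambiguity_set p \<Y> (empirical n w) (\<zeta> n x)" for Q
        proof -
          have "\<bar>expected_cost \<Y> c Q z0 - expected_cost \<Y> c P z0\<bar>
              \<le> \<zeta> n x * (6 * (K + L * (1/2 + 2 * \<zeta> n x)) + 3 * m + 4 * (L * (\<zeta> n x)\<^sup>2))"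
            unfolding expected_cost_def
            by (rule ambiguity_set_expectation_diff[OF n assms(38) \<Y>_closed w P \<pi>(1) \<zeta>_pos[OF n] \<pi>(2)
                  iii(2)[OF z0(1)] gr KL m int Q])
          also have "\<dots> \<le> \<zeta> n x * C1"
            unfolding C1_def using b[of n] \<zeta>_pos[OF n] KL
            by (intro mult_left_mono add_mono power_mono) auto
          finally show ?thesis by (simp add: mult.commute)
        qed
        have zh: "zhat n \<omega> x \<in> Z" "\<And>z. z \<in> Z \<Longrightarrow> obj n \<omega> x (\<zeta> n x) (zhat n \<omega> x) \<le> obj n \<omega> x (\<zeta> n x) z"
          using elim(5) n \<omega> by blast+
        have bdd: "bdd_above ((\<lambda>Q. expected_cost \<Y> c Q z) ` ambiguity_set p \<Y> (empirical n w) (\<zeta> n x))"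
          if "z \<in> Z" for z
          using assms(30)[OF n _ elim(1) _ that, of \<omega> "\<zeta> n x"] \<omega> \<zeta>_pos[OF n] unfolding Phat by auto
        show ?thesis
          using dro_sandwich[OF P_in z0[unfolded g_eq] bdd zh[unfolded obj_def Phat] diff]
          unfolding vDRO_def vstar_def obj_def Phat g_eq by blast
      qed
      then show ?thesis using B by (intro bexI[of _ B]) auto
    qed
    have "(\<lambda>\<omega>. g (zhat n \<omega> x) x) \<in> borel_measurable M" if "n \<ge> 1" for n
    proof -
      have "(\<lambda>\<omega>. zhat n \<omega> x) \<in> M \<rightarrow>\<^sub>M restrict_space borel Z"
        using elim(5) that by (intro measurable_restrict_space2) auto
      then show ?thesis
        using lsc_on_borel_measurable[OF elim(3)] by (rule measurable_compose)
    qed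
    moreover have "(\<lambda>\<omega>. vDRO n \<omega> x) \<in> borel_measurable M" if "n \<ge> 1" for n
      using elim(4) that by blast
    moreover have "\<alpha> \<longlonglongrightarrow> 0"
      using iv(2) by (rule summable_LIMSEQ_zero)
    ultimately show ?case
      using good \<zeta>_pos
      by (intro conjI big_Op_deterministicI[OF assms(25), where \<beta> = \<alpha> and K = C1]) (auto, blast+)
  qed
qed

end
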